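(* Let $I$ and $J$ be compositions of $n$, and let $\mathrm{PP}(I,J)$ be the set of permutations $\sigma\in S_n$ with $\mathrm{LC}(\sigma)=I$ and whose recoil composition is coarser than or equal to $J$. Then the coefficient $E_I^J(q)$ of $L_I(q)$ in $S^J(q)$ is \[ E_I^J(q)=q^{-\mathrm{maj}(\bar I)}\sum_{\sigma\in\mathrm{PP}(I,J)}q^{\mathrm{inv}(\sigma)}. \]
   Context: Compositions: $I=(i_1,\dots,i_r)$ positive integers summing to $n$; $\mathrm{Des}(I)=\{i_1,\dots,i_1+\dots+i_{r-1}\}$; $I\preceq J$ ($I$ finer, $J$ coarser) iff $\mathrm{Des}(I)\supseteq\mathrm{Des}(J)$; $\bar I=(i_r,\dots,i_1)$; $\mathrm{maj}(I)=\sum_{t=1}^r(r-t)i_t$; for $I\preceq J$, $\mathrm{st}(I,J)=\#\{(a,b)\in\mathrm{Des}(I)\times\mathrm{Des}(J):a\ge b\}$. For $\sigma\in S_n$: $\mathrm{inv}(\sigma)$ is its number of inversions; its recoil composition is the composition of $n$ with descent set $\{i:\sigma^{-1}(i)>\sigma^{-1}(i+1)\}$. $\mathrm{LC}(\sigma)$: let $c_i$ be the number of letters of $\sigma$ to the left of $i$ and greater than $i$; start with $S=\emptyset$ and for $t=n,n-1,\dots,1$, if $c_t>|S|$ add to $S$ the $(c_t-|S|)$-th smallest element of $\{1,\dots,n\}\setminus S$; the final $S$ is the descent set of a composition $C$ of $n$, and $\mathrm{LC}(\sigma)=\bar C$. Algebraic setting over $\mathbb K(q)$ ($\mathrm{char}\,\mathbb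 K=0$): packed words are words whose letter set is $\{1,\dots,m\}$; $\mathrm{pack}$ replaces the $t$-th smallest letter by $t$. For a packed word $w$ of length $n$: $\mathrm{WC}(w)$ is the composition of $n$ whose descent set is the set of positions $p<n$ with $w_p$ not occurring in $w_{p+1}\cdots w_n$; $\mathrm{sinv}(w)=\#\{i<j:w_i>w_j,\ w_j\text{ not occurring in }w_{j+1}\cdots w_n\}$. $\mathbf{WQSym}$ has basis $\mathbf M_u$ ($u$ packed) with $\mathbf M_{u'}\mathbf M_{u''}=\sum\mathbf M_u$ over packed $u=v\cdot w$ with $\mathrm{pack}(v)=u'$, $\mathrm{pack}(w)=u''$; $\mathbf M_{u'}\star_q\mathbf M_{u''}=\sum q^{\mathrm{sinv}(u)-\mathrm{sinv}(u')-\mathrm{sinv}(u'')}\mathbf M_u$ (associative). $\mathbf{Sym}$ is the quotient by the span of $\mathbf M_u-\mathbf M_v$ with $\mathrm{WC}(u)=\mathrm{WC}(v)$, $\zeta$ the quotient map, $\Psi_I=\zeta(\mathbf M_u)$ for $\mathrm{WC}(u)=I$ (a basis). $\tilde S_m=\sum\mathbf M_u$ over nondecreasing packed $u$ of length $m$; $S^J(q)=\zeta(\tilde S_{j_1}\star_q\cdots\star_q\tilde S_{j_l})$; $L_J(q)=\sum_{I\preceq J}q^{\mathrm{st}(I,J)}\Psi_I$ (a basis). *)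

theory Defs
  imports "HOL-Computational_Algebra.Polynomial" "HOL-Computational_Algebra.Fraction_Field"
          "HOL-Combinatorics.Permutations"
begin

definition is_comp :: "nat \<Rightarrow> nat list \<Rightarrow> bool" where
  "is_comp n I \<longleftrightarrow> sum_list I = n \<and> (\<forall>x\<in>set I. 0 < x)"

definition comps :: "nat \<Rightarrow> nat list set" where
  "comps n = {I. is_comp n I}"

definition Des :: "nat list \<Rightarrow> nat set" where
  "Des I = {sum_list (take k I) | k. 0 < k \<and> k < length I}"

definition comp_of_des :: "nat \<Rightarrow> nat set \<Rightarrow> nat list" where
  "comp_of_des n S = (THE I. is_comp n I \<and> Des I = S)"

definition finer :: "nat list \<Rightarrow> nat list \<Rightarrow> bool" where
  "finer I J \<longleftrightarrow> Des J \<subseteq> Des I"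

text \<open>maj(I) = sum_{t=1}^r (r-t) i_t  (0-indexed: t < r, weight r-1-t)\<close>
definition maj :: "nat list \<Rightarrow> nat" where
  "maj I = (\<Sum>t<length I. (length I - 1 - t) * I ! t)"

definition st :: "nat list \<Rightarrow> nat list \<Rightarrow> nat" where
  "st I J = card {(a, b). a \<in> Des I \<and> b \<in> Des J \<and> b \<le> a}"

definition inv_count :: "nat \<Rightarrow> (nat \<Rightarrow> nat) \<Rightarrow> nat" where
  "inv_count n \<sigma> = card {(i, j). i \<in> {1..n} \<and> j \<in> {1..n} \<and> i < j \<and> \<sigma> j < \<sigma> i}"

definition recoil :: "nat \<Rightarrow> (nat \<Rightarrow> nat) \<Rightarrow> nat list" where
  "recoil n \<sigma> = comp_of_des n {i \<in> {1..<n}. inv \<sigma> (i + 1) < inv \<sigma> i}"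

definition lc_c :: "nat \<Rightarrow> (nat \<Rightarrow> nat) \<Rightarrow> nat \<Rightarrow> nat" where
  "lc_c n \<sigma> i = card {j \<in> {1..n}. i < j \<and> inv \<sigma> j < inv \<sigma> i}"

definition kth_smallest :: "nat set \<Rightarrow> nat \<Rightarrow> nat" where
  "kth_smallest A k = sorted_list_of_set A ! (k - 1)"

definition LC_set :: "nat \<Rightarrow> (nat \<Rightarrow> nat) \<Rightarrow> nat set" where
  "LC_set n \<sigma> = foldl (\<lambda>S t. if card S < lc_c n \<sigma> t
        then insert (kth_smallest ({1..n} - S) (lc_c n \<sigma> t - card S)) S else S)
      {} (rev [1..<n+1])"

definition LC :: "nat \<Rightarrow> (nat \<Rightarrow> nat) \<Rightarrow> nat list" where
  "LC n \<sigma> = rev (comp_of_des n (LC_set n \<sigma>))"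

definition PP :: "nat \<Rightarrow> nat list \<Rightarrow> nat list \<Rightarrow> (nat \<Rightarrow> nat) set" where
  "PP n I J = {\<sigma>. \<sigma> permutes {1..n} \<and> LC n \<sigma> = I \<and> Des (recoil n \<sigma>) \<subseteq> Des J}"

definition pack :: "nat list \<Rightarrow> nat list" where
  "pack w = map (\<lambda>x. card {y \<in> set w. y \<le> x}) w"

definition packed :: "nat list \<Rightarrow> bool" where
  "packed w \<longleftrightarrow> set w = {1..card (set w)}"

definition WC :: "nat list \<Rightarrow> nat list" where
  "WC w = comp_of_des (length w)
     {p \<in> {1..<length w}. w ! (p - 1) \<notin> set (drop p w)}"

definition sinv :: "nat list \<Rightarrow> nat" where
  "sinv w = card {(i, j). j < length w \<and> i < j \<and> w ! j < w ! i \<and> w ! j \<notin> set (drop (Suc j) w)}"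

text \<open>Elements of WQSym over a coefficient field are represented by their coefficient
  functions in the basis M_u (u packed): f u = coefficient of M_u.\<close>
type_synonym 'a wqsym = "nat list \<Rightarrow> 'a"

definition qvar :: "'k::field_char_0 poly fract" where
  "qvar = Fract [:0, 1:] 1"

text \<open>The q-deformed product (bilinear extension of M_u' *_q M_u'').\<close>
definition qstar :: "'k::field_char_0 poly fract wqsym \<Rightarrow> 'k poly fract wqsym \<Rightarrow> 'k poly fract wqsym" where
  "qstar f g u = (if packed u then
      (\<Sum>k\<in>{0..length u}. f (pack (take k u)) * g (pack (drop k u)) *
          qvar powi (int (sinv u) - int (sinv (pack (take k u))) - int (sinv (pack (drop k u)))))
    else 0)"

definition wq_one :: "'a::zero_neq_one wqsym" where
  "wq_one u = (if u = [] then 1 else 0)"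

definition Stilde :: "nat \<Rightarrow> 'a::zero_neq_one wqsym" where
  "Stilde m u = (if packed u \<and> length u = m \<and> sorted u then 1 else 0)"

definition packed_words :: "nat \<Rightarrow> nat list set" where
  "packed_words n = {u. length u = n \<and> packed u}"

text \<open>Elements of Sym (degree n) represented by coefficient functions in the basis Psi_I;
  zeta(M_u) = Psi_{WC(u)}.\<close>
definition zeta :: "nat \<Rightarrow> 'a::comm_monoid_add wqsym \<Rightarrow> nat list \<Rightarrow> 'a" where
  "zeta n f I = (\<Sum>u\<in>{u \<in> packed_words n. WC u = I}. f u)"

definition SJ :: "nat list \<Rightarrow> nat list \<Rightarrow> 'k::field_char_0 poly fract" where
  "SJ J = zeta (sum_list J) (foldr qstar (map Stilde J) wq_one)"

text \<open>L_J(q) = sum_{I finer J} q^{st(I,J)} Psi_I, as coefficient function in Psi basis\<close>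
definition LJ :: "nat list \<Rightarrow> nat list \<Rightarrow> 'k::field_char_0 poly fract" where
  "LJ J I = (if finer I J then qvar ^ st I J else 0)"

text \<open>Coefficient of L_I(q) in an element F of Sym_n (L is a basis of Sym_n).\<close>
definition L_coeff :: "nat \<Rightarrow> (nat list \<Rightarrow> 'k::field_char_0 poly fract) \<Rightarrow> nat list \<Rightarrow> 'k poly fract" where
  "L_coeff n F = (THE c. (\<forall>I. I \<notin> comps n \<longrightarrow> c I = 0) \<and>
        (\<forall>K \<in> comps n. F K = (\<Sum>I\<in>comps n. c I * LJ I K)))"

end

theory Submission
  imports Defs
begin

text \<open>
  Encode a word \<open>u\<close> of length \<open>n\<close> by \<open>b\<close>, where \<open>b\<^sub>t\<close> is the number of distinct values to the right
  of position \<open>t\<close> that are smaller than \<open>u\<^sub>t\<close>. Then \<open>sinv u\<close> is the sum of \<open>b\<close>, the words \<open>u\<close> and \<open>b\<close>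
  have the same descents, and the packed words with \<open>WC u = K\<close> correspond to all sequences with
  \<open>b\<^sub>t \<le> card {e \<in> E. e \<le> n - t}\<close>, where \<open>E = {n - d | d. d \<in> Des K}\<close>. For \<open>E = {1..<n}\<close> the words
  are the inverses of the permutations, and \<open>b\<close> is the sequence \<open>c\<close> that drives the algorithm for LC.

  For every \<open>E\<close>, run that algorithm on \<open>b\<close>, choosing new elements of \<open>S\<close> inside \<open>E\<close>: if
  \<open>b\<^sub>t \<le> card S\<close> record \<open>b\<^sub>t\<close>; otherwise record the element of \<open>E - S\<close> of rank \<open>b\<^sub>t - card S\<close> and add it
  to \<open>S\<close>. The record determines \<open>b\<close>, its descents do not depend on \<open>E\<close>, and the records that occur for
  \<open>E\<close> are those occurring for \<open>{1..<n}\<close> whose final \<open>S\<close> lies in \<open>E\<close>. Passing from \<open>{1..<n}\<close> to \<open>E\<close> lowers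
  the sum by the number of pairs \<open>x \<le> s\<close> with \<open>s \<in> S\<close> and \<open>x \<notin> E\<close>, which is \<open>maj (rev I) - st K I\<close>
  when \<open>Des (rev I) = S\<close>. Hence the coefficients of \<open>S\<^sup>J\<close> in the basis \<open>\<Psi>\<close> expand as claimed in the
  basis \<open>L\<close>, and triangularity of \<open>L\<close> gives uniqueness.
\<close>

subsection \<open>Compositions and descent sets\<close>

lemma Des_Nil [simp]: "Des [] = {}" and Des_single [simp]: "Des [x] = {}"
  by (auto simp: Des_def)

lemma Des_image: "Des I = (\<lambda>k. sum_list (take k I)) ` {0<..<length I}"
  by (auto simp: Des_def)

lemma Des_snoc:
  assumes "I \<noteq> []"
  shows "Des (I @ [x]) = insert (sum_list I) (Des I)"
proof -
  have "{0<..<length (I @ [x])} = insert (length I) {0<..<length I}"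
    using assms by auto
  then show ?thesis by (simp add: Des_image)
qed

lemma is_comp_snoc: "is_comp n (I @ [x]) \<longleftrightarrow> 0 < x \<and> x \<le> n \<and> is_comp (n - x) I"
  by (auto simp: is_comp_def)

lemma is_comp_sum_pos: "is_comp n I \<Longrightarrow> I \<noteq> [] \<Longrightarrow> 0 < n"
  by (cases I) (auto simp: is_comp_def)

lemma Des_subset: "is_comp n I \<Longrightarrow> Des I \<subseteq> {1..<n}"
proof (induction I arbitrary: n rule: rev_induct)
  case (snoc x I)
  show ?case
  proof (cases "I = []")
    case False
    have I: "is_comp (n - x) I" and x: "0 < x" "x \<le> n"
      using snoc.prems by (auto simp: is_comp_snoc)
    have "0 < n - x" using is_comp_sum_pos[OF I False] .
    moreover have "sum_list I = n - x" using I by (simp add: is_comp_def)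
    ultimately show ?thesis using snoc.IH[OF I] x False by (force simp: Des_snoc)
  qed simp
qed simp

lemma finite_Des [simp]: "finite (Des I)"
  by (simp add: Des_def)

lemma Max_Des_snoc:
  assumes "is_comp n (I @ [x])" "I \<noteq> []"
  shows "Max (Des (I @ [x])) = sum_list I" "sum_list I \<notin> Des I"
proof -
  have "is_comp (sum_list I) I" using assms by (auto simp: is_comp_def)
  from Des_subset[OF this] have "Des I \<subseteq> {1..<sum_list I}" .
  then show "Max (Des (I @ [x])) = sum_list I" "sum_list I \<notin> Des I"
    using assms(2) by (auto simp: Des_snoc intro!: Max_eqI)
qed

text \<open>With at least two parts, the largest element of the descent set is the sum of all parts
  but the last, so it fixes the last part; removing it leaves the descent set of the other
  parts.\<close>

lemma Des_inject:
  assumes "is_comp n I" "is_comp n J" "Des I = Des J"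
  shows "I = J"
  using assms
proof (induction I arbitrary: n J rule: rev_induct)
  case Nil
  then show ?case by (cases J) (auto simp: is_comp_def)
next
  case (snoc x I)
  have "J \<noteq> []" using snoc.prems by (auto simp: is_comp_def)
  then obtain J' y where J: "J = J' @ [y]" by (cases J rule: rev_cases) auto
  show ?case
  proof (cases "I = [] \<or> J' = []")
    case True
    then have "I = [] \<and> J' = []"
      using snoc.prems(3) J Des_snoc[of I x] Des_snoc[of J' y]
      by (metis Des_single append_Nil insert_not_empty)
    then show ?thesis using snoc.prems J by (auto simp: is_comp_def)
  next
    case False
    have s: "sum_list I = sum_list J'"
      using Max_Des_snoc(1)[of n I x] Max_Des_snoc(1)[of n J' y] snoc.prems False J by simp
    have "Des I = Des J'"
      using Max_Des_snoc(2)[of n I x] Max_Des_snoc(2)[of n J' y] snoc.prems False J s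
      by (simp add: Des_snoc insert_ident)
    moreover have "is_comp (sum_list I) I" "is_comp (sum_list I) J'"
      using snoc.prems J s by (auto simp: is_comp_def)
    ultimately have "I = J'" using snoc.IH by blast
    then show ?thesis using snoc.prems J by (auto simp: is_comp_def)
  qed
qed

text \<open>The last part has to be n minus the maximum of S, and the rest of S describes a
  composition of that maximum.\<close>

lemma Des_surj:
  assumes "S \<subseteq> {1..<n}"
  shows "\<exists>I. is_comp n I \<and> Des I = S"
  using assms
proof (induction n arbitrary: S rule: less_induct)
  case (less n)
  show ?case
  proof (cases "S = {}")
    case True
    have "is_comp n (if n = 0 then [] else [n]) \<and> Des (if n = 0 then [] else [n]) = {}"
      by (auto simp: is_comp_def)
    then show ?thesis using True by blast
  next
    case False
    define m where "m = Max S"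
    have fin: "finite S" using less.prems finite_subset by blast
    then have m: "m \<in> S" using False by (simp add: m_def)
    then have mn: "0 < m" "m < n" using less.prems by auto
    have "S - {m} \<subseteq> {1..<m}"
    proof
      fix x assume "x \<in> S - {m}"
      moreover from this have "x \<le> m" using fin by (simp add: m_def)
      ultimately show "x \<in> {1..<m}" using less.prems by auto
    qed
    then obtain I where I: "is_comp m I" "Des I = S - {m}" using less.IH mn by blast
    have "I \<noteq> []" "sum_list I = m" using I mn by (auto simp: is_comp_def)
    then have "Des (I @ [n - m]) = S" using I m by (auto simp: Des_snoc)
    moreover have "is_comp n (I @ [n - m])" using I mn by (simp add: is_comp_def)
    ultimately show ?thesis by blast
  qed
qed

lemma comp_of_des:
  assumes "S \<subseteq> {1..<n}"
  shows is_comp_comp_of_des: "is_comp n (comp_of_des n S)"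
    and Des_comp_of_des: "Des (comp_of_des n S) = S"
proof -
  have "\<exists>!I. is_comp n I \<and> Des I = S"
    using Des_surj[OF assms] Des_inject by blast
  from theI'[OF this] show "is_comp n (comp_of_des n S)" "Des (comp_of_des n S) = S"
    unfolding comp_of_des_def by auto
qed

lemma comp_of_des_eq_iff:
  assumes "S \<subseteq> {1..<n}" "is_comp n I"
  shows "comp_of_des n S = I \<longleftrightarrow> Des I = S"
  using comp_of_des[OF assms(1)] assms(2) Des_inject by blast

lemma finite_comps [simp]: "finite (comps n)"
proof (rule finite_imageD)
  show "finite (Des ` comps n)"
    by (rule finite_subset[of _ "Pow {1..<n}"]) (use Des_subset in \<open>auto simp: comps_def\<close>)
  show "inj_on Des (comps n)"
    using Des_inject by (auto simp: inj_on_def comps_def)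
qed

lemma is_comp_rev [simp]: "is_comp n (rev I) \<longleftrightarrow> is_comp n I"
  by (simp add: is_comp_def)

text \<open>A partial sum of the reversed composition is n minus the partial sum of the
  complementary length.\<close>

lemma Des_rev:
  assumes "is_comp n I"
  shows "Des (rev I) = (\<lambda>d. n - d) ` Des I"
proof -
  have *: "sum_list (take k (rev I)) = n - sum_list (take (length I - k) I)" for k
  proof -
    have "sum_list (take (length I - k) I) + sum_list (drop (length I - k) I) = n"
      using assms by (metis append_take_drop_id is_comp_def sum_list_append)
    then show ?thesis by (simp add: take_rev)
  qed
  have inv: "{0<..<length I} = (\<lambda>k. length I - k) ` {0<..<length I}"
  proof (intro equalityI subsetI)
    fix k assume "k \<in> {0<..<length I}"
    then show "k \<in> (\<lambda>k. length I - k) ` {0<..<length I}"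
      by (intro image_eqI[of _ _ "length I - k"]) auto
  qed auto
  have "Des (rev I) = (\<lambda>k. n - sum_list (take (length I - k) I)) ` {0<..<length I}"
    by (simp add: Des_image *)
  also have "\<dots> = (\<lambda>k. n - sum_list (take k I)) ` {0<..<length I}"
    by (subst (2) inv) (simp add: image_image)
  also have "\<dots> = (\<lambda>d. n - d) ` Des I"
    by (simp add: Des_image image_image)
  finally show ?thesis .
qed

text \<open>Appending a part raises the weight of every earlier part by one, which adds
  \<open>sum_list I\<close>, exactly the new descent.\<close>

lemma maj_eq_sum_Des:
  assumes "is_comp n I"
  shows "maj I = \<Sum>(Des I)"
  using assms
proof (induction I arbitrary: n rule: rev_induct)
  case Nil
  then show ?case by (simp add: maj_def)
next
  case (snoc x I)
  have I: "is_comp (n - x) I" using snoc.prems by (simp add: is_comp_snoc)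
  show ?case
  proof (cases "I = []")
    case True
    then show ?thesis by (simp add: maj_def)
  next
    case False
    have "maj (I @ [x]) = (\<Sum>t<length I. (length I - 1 - t) * I ! t + I ! t)"
    proof -
      have "length I - t = Suc (length I - 1 - t)" if "t < length I" for t
        using that by simp
      then show ?thesis by (simp add: maj_def nth_append add.commute)
    qed
    also have "\<dots> = maj I + sum_list I"
      by (simp add: sum.distrib maj_def sum_list_sum_nth atLeast0LessThan)
    finally show ?thesis
      using snoc.IH[OF I] Max_Des_snoc(2)[OF snoc.prems False] False
      by (simp add: Des_snoc)
  qed
qed

subsection \<open>Codes of words\<close>

text \<open>A position \<open>p\<close> of a word of length \<open>n\<close> is recorded as \<open>n - p\<close>, the number of letters after it, so
  that it does not change when letters are prepended.\<close>

definition suffix_lengths :: "('a list \<Rightarrow> bool) \<Rightarrow> 'a list \<Rightarrow> nat set" where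
  "suffix_lengths P u = {e \<in> {1..<length u}. P (drop (length u - Suc e) u)}"

lemma suffix_lengths_Nil [simp]: "suffix_lengths P [] = {}"
  by (simp add: suffix_lengths_def)

lemma suffix_lengths_Cons:
  "suffix_lengths P (x # xs) =
    (if xs \<noteq> [] \<and> P (x # xs) then insert (length xs) (suffix_lengths P xs)
     else suffix_lengths P xs)"
proof -
  have "drop (length xs - e) (x # xs) = drop (length xs - Suc e) xs" if "e < length xs" for e
    using that by (simp add: drop_Cons' )
  then show ?thesis
    by (auto simp: suffix_lengths_def less_Suc_eq Suc_le_eq)
qed

lemma suffix_lengths_subset: "suffix_lengths P u \<subseteq> {1..<length u}"
  by (auto simp: suffix_lengths_def)

lemma finite_suffix_lengths [simp]: "finite (suffix_lengths P u)"
  using suffix_lengths_subset finite_subset by blast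

lemma length_notin_suffix_lengths [simp]: "length u \<notin> suffix_lengths P u"
  using suffix_lengths_subset[of P u] by auto

lemma reflect_suffix_lengths:
  "(\<lambda>e. length u - e) ` suffix_lengths P u = {p \<in> {1..<length u}. P (drop (p - 1) u)}"
proof (intro equalityI subsetI)
  fix p assume p: "p \<in> {p \<in> {1..<length u}. P (drop (p - 1) u)}"
  then have "length u - p \<in> suffix_lengths P u"
    by (auto simp: suffix_lengths_def)
  then show "p \<in> (\<lambda>e. length u - e) ` suffix_lengths P u"
    using p by (intro image_eqI[of _ _ "length u - p"]) auto
next
  fix p assume "p \<in> (\<lambda>e. length u - e) ` suffix_lengths P u"
  then obtain e where "p = length u - e" "e \<in> {1..<length u}" "P (drop (length u - Suc e) u)"
    by (auto simp: suffix_lengths_def)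
  then show "p \<in> {p \<in> {1..<length u}. P (drop (p - 1) u)}" by auto
qed

text \<open>Reflected by e -> n - e, this is the descent set of \<open>WC\<close>. The final letter,
  with e = 0, is left out, just as only positions p < n are candidates there.\<close>

abbreviation last_occ :: "nat list \<Rightarrow> nat set" where
  "last_occ \<equiv> suffix_lengths (\<lambda>s. hd s \<notin> set (tl s))"

abbreviation descs :: "nat list \<Rightarrow> nat set" where
  "descs \<equiv> suffix_lengths (\<lambda>s. hd (tl s) < hd s)"

fun word_code :: "nat list \<Rightarrow> nat list" where
  "word_code [] = []"
| "word_code (x # xs) = card {v \<in> set xs. v < x} # word_code xs"

lemma length_word_code [simp]: "length (word_code u) = length u"
  by (induction u) auto

lemma word_code_eq_Nil [simp]: "word_code u = [] \<longleftrightarrow> u = []"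
  by (cases u) auto

lemma hd_word_code: "xs \<noteq> [] \<Longrightarrow> hd (word_code xs) = card {v \<in> set xs. v < hd xs}"
proof (cases xs)
  case (Cons y ys)
  have "{v \<in> set ys. v < y} = {v \<in> set (y # ys). v < y}" by auto
  then show ?thesis using Cons by simp
qed simp

lemma card_less_less_iff:
  assumes "finite A" "y \<in> A"
  shows "card {v \<in> A. v < y} < card {v \<in> A. v < x} \<longleftrightarrow> y < (x::nat)"
proof
  assume "y < x"
  then show "card {v \<in> A. v < y} < card {v \<in> A. v < x}"
    using assms by (intro psubset_card_mono) auto
next
  assume l: "card {v \<in> A. v < y} < card {v \<in> A. v < x}"
  show "y < x"
  proof (rule ccontr)
    assume "\<not> y < x"
    then have "card {v \<in> A. v < x} \<le> card {v \<in> A. v < y}"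
      using assms by (intro card_mono) auto
    then show False using l by simp
  qed
qed

text \<open>Neighbouring entries count the values in one common set below two letters, the right one
  of which lies in that set; such counts compare like the letters.\<close>

lemma descs_word_code [simp]: "descs (word_code u) = descs u"
proof (induction u)
  case (Cons x xs)
  have "hd (word_code xs) < card {v \<in> set xs. v < x} \<longleftrightarrow> hd xs < x" if "xs \<noteq> []"
    using that card_less_less_iff[of "set xs" "hd xs" x] by (simp add: hd_word_code)
  then show ?case using Cons by (auto simp: suffix_lengths_Cons)
qed simp

lemma word_code_map:
  assumes "strict_mono_on (set u) (f :: nat \<Rightarrow> nat)"
  shows "word_code (map f u) = word_code u \<and> last_occ (map f u) = last_occ u"
  using assms
proof (induction u)
  case (Cons x xs)
  have m: "strict_mono_on (set xs) f"
    using Cons.prems by (auto simp: strict_mono_on_def)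
  have less: "f a < f b \<longleftrightarrow> a < b" if "a \<in> insert x (set xs)" "b \<in> insert x (set xs)" for a b
    using strict_mono_on_less[OF Cons.prems, of a b] that by simp
  have inj: "inj_on f (insert x (set xs))"
    using strict_mono_on_imp_inj_on[OF Cons.prems] by simp
  have "{v \<in> f ` set xs. v < f x} = f ` {v \<in> set xs. v < x}" using less by auto
  moreover have "inj_on f {v \<in> set xs. v < x}" using inj by (auto simp: inj_on_def)
  moreover have "f x \<in> f ` set xs \<longleftrightarrow> x \<in> set xs" using inj by (auto simp: inj_on_def)
  ultimately show ?case using Cons.IH[OF m] by (simp add: card_image suffix_lengths_Cons)
qed simp

lemma descs_map:
  assumes "strict_mono_on (set u) (f :: nat \<Rightarrow> nat)"
  shows "descs (map f u) = descs u"
  using word_code_map[OF assms] descs_word_code by metis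

section \<open>Packing, and packed words recovered from their codes\<close>

lemma strict_mono_on_rank:
  "finite A \<Longrightarrow> strict_mono_on A (\<lambda>x::nat. card {y \<in> A. y \<le> x})"
  by (rule strict_mono_onI, rule psubset_card_mono) (auto dest: leD)

lemma
  shows word_code_pack [simp]: "word_code (pack u) = word_code u"
    and last_occ_pack [simp]: "last_occ (pack u) = last_occ u"
    and descs_pack [simp]: "descs (pack u) = descs u"
  using word_code_map descs_map strict_mono_on_rank[of "set u"] unfolding pack_def by blast+

lemma length_pack [simp]: "length (pack u) = length u"
  by (simp add: pack_def)

lemma rank_image:
  assumes "finite A"
  shows "(\<lambda>x::nat. card {y \<in> A. y \<le> x}) ` A = {1..card A}"
proof (rule card_subset_eq)
  show "(\<lambda>x. card {y \<in> A. y \<le> x}) ` A \<subseteq> {1..card A}"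
  proof (rule image_subsetI)
    fix x assume "x \<in> A"
    then have "0 < card {y \<in> A. y \<le> x}" using assms by (auto simp: card_gt_0_iff)
    moreover have "card {y \<in> A. y \<le> x} \<le> card A" using assms by (intro card_mono) auto
    ultimately show "card {y \<in> A. y \<le> x} \<in> {1..card A}" by simp
  qed
  show "card ((\<lambda>x. card {y \<in> A. y \<le> x}) ` A) = card {1..card A}"
    using strict_mono_on_imp_inj_on[OF strict_mono_on_rank[OF assms]] by (simp add: card_image)
qed simp

lemma packed_pack [simp]: "packed (pack u)"
  by (simp add: packed_def pack_def rank_image)

lemma pack_packed:
  assumes "packed u"
  shows "pack u = u"
proof -
  obtain m where m: "set u = {1..m}" using assms packed_def by blast
  have "card {y \<in> set u. y \<le> x} = x" if "x \<in> set u" for x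
  proof -
    have "{y \<in> set u. y \<le> x} = {1..x}" using that m by auto
    then show ?thesis by simp
  qed
  then show ?thesis unfolding pack_def by (simp add: map_idI)
qed

text \<open>The head is fixed by the code entry, and a new value pushes up by one exactly the ranks
  beyond that entry. Hence \<open>pack\<close> can be rebuilt from right to left from the code and
  the information which letters are new.\<close>

lemma pack_Cons:
  "pack (x # xs) = Suc (card {v \<in> set xs. v < x}) #
    (if x \<in> set xs then pack xs
     else map (\<lambda>r. if card {v \<in> set xs. v < x} < r then Suc r else r) (pack xs))"
proof -
  have hd: "card {y \<in> set (x # xs). y \<le> x} = Suc (card {v \<in> set xs. v < x})"
  proof -
    have "{y \<in> set (x # xs). y \<le> x} = insert x {v \<in> set xs. v < x}" by auto
    then show ?thesis by simp
  qed
  show ?thesis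
  proof (cases "x \<in> set xs")
    case True
    then show ?thesis using hd by (simp add: pack_def insert_absorb)
  next
    case False
    have "card {y \<in> set (x # xs). y \<le> z} =
      (if card {v \<in> set xs. v < x} < card {y \<in> set xs. y \<le> z}
       then Suc (card {y \<in> set xs. y \<le> z}) else card {y \<in> set xs. y \<le> z})"
      if z: "z \<in> set xs" for z
    proof (cases "x < z")
      case True
      have "{y \<in> set (x # xs). y \<le> z} = insert x {y \<in> set xs. y \<le> z}" using True by auto
      moreover have "card {v \<in> set xs. v < x} < card {y \<in> set xs. y \<le> z}"
      proof (rule psubset_card_mono)
        have "z \<in> {y \<in> set xs. y \<le> z}" "z \<notin> {v \<in> set xs. v < x}" using True z by auto
        moreover have "{v \<in> set xs. v < x} \<subseteq> {y \<in> set xs. y \<le> z}" using True by auto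
        ultimately show "{v \<in> set xs. v < x} \<subset> {y \<in> set xs. y \<le> z}" by blast
      qed simp
      ultimately show ?thesis using False by simp
    next
      case nl: False
      then have "z < x" using z False by (metis linorder_neqE_nat)
      then have "{y \<in> set (x # xs). y \<le> z} = {y \<in> set xs. y \<le> z}" by auto
      moreover have "card {y \<in> set xs. y \<le> z} \<le> card {v \<in> set xs. v < x}"
        using \<open>z < x\<close> by (intro card_mono) auto
      ultimately show ?thesis by simp
    qed
    then show ?thesis using hd False by (simp add: pack_def)
  qed
qed

lemma pack_eqI:
  assumes "word_code u = word_code v" "last_occ u = last_occ v"
  shows "pack u = pack v"
proof -
  have "length u = length v" using assms(1) by (metis length_word_code)
  then show ?thesis using assms
  proof (induction u v rule: list_induct2)
    case (Cons x xs y ys)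
    have new: "length xs \<in> last_occ (x # xs) \<longleftrightarrow> xs \<noteq> [] \<and> x \<notin> set xs"
      by (simp add: suffix_lengths_Cons)
    have new': "length xs \<in> last_occ (y # ys) \<longleftrightarrow> ys \<noteq> [] \<and> y \<notin> set ys"
      using Cons.hyps by (simp add: suffix_lengths_Cons)
    \<comment> \<open>\<open>last_occ\<close> says nothing about x when the tail is empty, but then
      both words have one letter and pack to the same word.\<close>
    have eq: "(xs \<noteq> [] \<and> x \<notin> set xs) = (ys \<noteq> [] \<and> y \<notin> set ys)"
      using new new' Cons.prems(2) by simp
    have "last_occ xs = last_occ (x # xs) - {length xs}" "last_occ ys = last_occ (y # ys) - {length ys}"
      by (auto simp: suffix_lengths_Cons)
    then have "last_occ xs = last_occ ys" using Cons.prems(2) Cons.hyps by simp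
    then have "pack xs = pack ys" using Cons by simp
    then show ?case using eq Cons.prems(1) Cons.hyps by (auto simp: pack_Cons)
  qed simp
qed

text \<open>Pairs with left position 0 end in last occurrences, one for each distinct value below x;
  all other pairs are those of xs, shifted by one.\<close>

lemma sinv_Cons: "sinv (x # xs) = card {v \<in> set xs. v < x} + sinv xs"
proof -
  let ?L = "{j. j < length xs \<and> xs ! j \<notin> set (drop (Suc j) xs)}"
  let ?A = "(\<lambda>j. (0, Suc j)) ` {j \<in> ?L. xs ! j < x}"
  let ?B = "{(i, j). j < length xs \<and> i < j \<and> xs ! j < xs ! i \<and> xs ! j \<notin> set (drop (Suc j) xs)}"
  let ?S = "{(i, j). j < length (x # xs) \<and> i < j \<and> (x # xs) ! j < (x # xs) ! i
      \<and> (x # xs) ! j \<notin> set (drop (Suc j) (x # xs))}"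
  \<comment> \<open>A value has just one last occurrence, so counting positions in \<open>?L\<close>
    is counting distinct values.\<close>
  have inj: "inj_on (nth xs) ?L"
  proof (rule inj_onI, rule ccontr)
    have *: "xs ! i \<in> set (drop (Suc j) xs)" if "j < i" "i < length xs" for i j
    proof -
      have "xs ! i = drop (Suc j) xs ! (i - Suc j)" using that by simp
      then show ?thesis using that by (metis diff_less_mono length_drop nth_mem Suc_leI)
    qed
    fix i j assume "i \<in> ?L" "j \<in> ?L" "xs ! i = xs ! j" "i \<noteq> j"
    then show False using *[of i j] *[of j i] by (cases i j rule: linorder_cases) auto
  qed
  have "nth xs ` {j \<in> ?L. xs ! j < x} = {v \<in> set xs. v < x}"
  proof (intro equalityI subsetI)
    fix v assume v: "v \<in> {v \<in> set xs. v < x}"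
    then obtain ys zs where "xs = ys @ v # zs" "v \<notin> set zs" by (auto dest: split_list_last)
    then show "v \<in> nth xs ` {j \<in> ?L. xs ! j < x}"
      using v by (intro image_eqI[of _ _ "length ys"]) auto
  qed auto
  then have "card {v \<in> set xs. v < x} = card (nth xs ` {j \<in> ?L. xs ! j < x})" by simp
  also have "\<dots> = card {j \<in> ?L. xs ! j < x}"
    by (intro card_image inj_on_subset[OF inj]) auto
  also have "\<dots> = card ?A"
    by (intro card_image[symmetric]) (auto simp: inj_on_def)
  finally have A: "card ?A = card {v \<in> set xs. v < x}" by (rule sym)
  have "?S = ?A \<union> map_prod Suc Suc ` ?B"
  proof (intro equalityI subsetI)
    fix p assume p: "p \<in> ?S"
    obtain i j where ij: "p = (i, j)" by (cases p)
    then obtain j' where j: "j = Suc j'" using p by (cases j) auto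
    show "p \<in> ?A \<union> map_prod Suc Suc ` ?B"
    proof (cases i)
      case 0
      then show ?thesis using p ij j by auto
    next
      case (Suc i')
      then have "p = map_prod Suc Suc (i', j')" "(i', j') \<in> ?B" using p ij j by auto
      then show ?thesis by blast
    qed
  qed auto
  moreover have "?A \<inter> map_prod Suc Suc ` ?B = {}" by auto
  moreover have "finite ?B"
    by (rule finite_subset[of _ "{..length xs} \<times> {..length xs}"]) auto
  moreover have "card (map_prod Suc Suc ` ?B) = card ?B"
    by (intro card_image) (auto simp: inj_on_def)
  ultimately show ?thesis
    unfolding sinv_def using A by (simp add: card_Un_disjoint)
qed

lemma sinv_eq_sum_word_code: "sinv u = sum_list (word_code u)"
  by (induction u) (simp_all add: sinv_Cons, simp add: sinv_def)

lemma sinv_pack [simp]: "sinv (pack u) = sinv u"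
  by (simp add: sinv_eq_sum_word_code)

section \<open>Codes as bounded sequences\<close>

lemma card_set_eq_last_occ: "xs \<noteq> [] \<Longrightarrow> card (set xs) = Suc (card (last_occ xs))"
proof (induction xs)
  case (Cons x xs)
  then show ?case by (cases "xs = []") (auto simp: suffix_lengths_Cons insert_absorb)
qed simp

text \<open>When E is the \<open>last_occ\<close> of a word, a nonempty tail has one distinct value
  more than there are e in E with e < length bs, since the final letter is a last occurrence outside
  \<open>last_occ\<close>. The bound is therefore the number of values to the right for a new letter
  and one less for a repeated one.\<close>

fun box :: "nat set \<Rightarrow> nat list \<Rightarrow> bool" where
  "box E [] \<longleftrightarrow> True"
| "box E (b # bs) \<longleftrightarrow> b \<le> card {e \<in> E. e \<le> length bs} \<and> box E bs"

lemma card_Collect_le_split: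
  fixes E :: "nat set"
  shows "card {e \<in> E. e \<le> m} = card {e \<in> E. e < m} + (if m \<in> E then 1 else 0)"
proof -
  have "{e \<in> E. e \<le> m} = (if m \<in> E then insert m {e \<in> E. e < m} else {e \<in> E. e < m})"
    by (auto simp: le_less)
  then show ?thesis by simp
qed

lemma box_word_code:
  assumes "last_occ u = {e \<in> E. e < length u}"
  shows "box E (word_code u)"
  using assms
proof (induction u)
  case (Cons x xs)
  have "last_occ xs = last_occ (x # xs) - {length xs}" by (auto simp: suffix_lengths_Cons)
  also have "\<dots> = {e \<in> E. e < length xs}" unfolding Cons.prems by auto
  finally have xs: "last_occ xs = {e \<in> E. e < length xs}" .
  have new: "length xs \<in> E \<longleftrightarrow> xs \<noteq> [] \<and> x \<notin> set xs"
  proof -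
    have "length xs \<in> E \<longleftrightarrow> length xs \<in> last_occ (x # xs)" using Cons.prems by simp
    then show ?thesis by (simp add: suffix_lengths_Cons)
  qed
  have "card {v \<in> set xs. v < x} \<le> card {e \<in> E. e \<le> length xs}"
  proof (cases "xs = []")
    case False
    have card: "card (set xs) = Suc (card {e \<in> E. e < length xs})"
      using card_set_eq_last_occ[OF False] xs by simp
    show ?thesis
    proof (cases "x \<in> set xs")
      case True
      then have "card {v \<in> set xs. v < x} < card (set xs)" by (intro psubset_card_mono) auto
      then show ?thesis using card by (simp add: card_Collect_le_split)
    next
      case nin: False
      have "card {v \<in> set xs. v < x} \<le> card (set xs)" by (intro card_mono) auto
      then show ?thesis using card new False nin by (simp add: card_Collect_le_split)
    qed
  qed simp
  then show ?case using Cons.IH[OF xs] by simp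
qed simp

lemma word_code_surj:
  assumes "box E b" "0 \<notin> E"
  shows "\<exists>u. word_code u = b \<and> last_occ u = {e \<in> E. e < length b}"
  using assms(1)
proof (induction b)
  case (Cons b bs)
  then obtain xs where xs: "word_code xs = bs" "last_occ xs = {e \<in> E. e < length bs}" by auto
  have len: "length bs = length xs" using xs(1) length_word_code by metis
  define m where "m = card (set xs)"
  \<comment> \<open>Doubling the letters keeps the code and opens odd slots below, between and above
    the values, where a new value can go.\<close>
  define ys where "ys = map ((*) 2) (pack xs)"
  have "strict_mono_on (set (pack xs)) ((*) (2::nat))" by (auto simp: strict_mono_on_def)
  from word_code_map[OF this] have ys: "word_code ys = bs" "last_occ ys = {e \<in> E. e < length bs}"
    using xs by (simp_all add: ys_def)
  have "set ys = (*) 2 ` {1..m}"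
    using arg_cong[OF rank_image[of "set xs"], of "image ((*) 2)"]
    by (simp add: ys_def m_def pack_def image_image)
  then have set_ys: "set ys = {v. even v \<and> 0 < v \<and> v \<le> 2 * m}"
    by (auto simp: image_iff elim!: evenE)
  have nil: "xs = [] \<longleftrightarrow> ys = []" by (simp add: ys_def pack_def)
  have lt: "card {v \<in> set ys. v < x} = b" if x: "x = 2 * b + 1 \<or> x = 2 * b + 2" and bm: "b \<le> m" for x
  proof -
    have "{v \<in> set ys. v < x} = (*) 2 ` {1..b}"
      unfolding set_ys using that by (auto simp: image_iff elim!: evenE)
    then show ?thesis by (simp add: card_image inj_on_def)
  qed
  have b: "b \<le> card {e \<in> E. e < length bs} + (if length bs \<in> E then 1 else 0)"
    using Cons.prems by (simp add: card_Collect_le_split)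
  show ?case
  proof (cases "xs = []")
    case True
    then have "ys = []" "bs = []" using nil ys by auto
    moreover have "{e \<in> E. e < Suc 0} = {}"
      using assms(2) by (auto simp: less_Suc_eq)
    moreover have "b = 0" using b assms(2) \<open>bs = []\<close> by simp
    ultimately have "word_code [0] = b # bs \<and> last_occ [0] = {e \<in> E. e < length (b # bs)}"
      by (simp add: suffix_lengths_Cons)
    then show ?thesis by blast
  next
    case False
    have m: "m = Suc (card {e \<in> E. e < length bs})"
      using card_set_eq_last_occ[OF False] xs by (simp add: m_def)
    \<comment> \<open>Both choices have exactly b values below them. The odd one is new; the even
      one is the value of rank b + 1, which exists because the bound then gives b < m.\<close>
    define x where "x = (if length bs \<in> E then 2 * b + 1 else 2 * b + 2)"
    have "b \<le> m" using b m by (auto split: if_splits)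
    then have "word_code (x # ys) = b # bs" using lt ys by (simp add: x_def)
    moreover have "x \<in> set ys \<longleftrightarrow> length bs \<notin> E"
      using b m by (auto simp: x_def set_ys)
    then have "last_occ (x # ys) = {e \<in> E. e < length (b # bs)}"
      using ys False nil len by (auto simp: suffix_lengths_Cons less_Suc_eq ys_def)
    ultimately show ?thesis by blast
  qed
qed simp

lemma bij_betw_word_code:
  assumes "E \<subseteq> {1..<n}"
  shows "bij_betw word_code {u \<in> packed_words n. last_occ u = E} {b. length b = n \<and> box E b}"
proof (rule bij_betw_imageI)
  show "inj_on word_code {u \<in> packed_words n. last_occ u = E}"
  proof (rule inj_onI)
    fix u v
    assume u: "u \<in> {u \<in> packed_words n. last_occ u = E}"
      and v: "v \<in> {u \<in> packed_words n. last_occ u = E}" and "word_code u = word_code v"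
    then have "pack u = pack v" by (intro pack_eqI) simp_all
    then show "u = v" using u v by (simp add: packed_words_def pack_packed)
  qed
  have E: "{e \<in> E. e < n} = E" using assms by auto
  show "word_code ` {u \<in> packed_words n. last_occ u = E} = {b. length b = n \<and> box E b}"
  proof (intro equalityI subsetI)
    fix b assume "b \<in> {b. length b = n \<and> box E b}"
    then have b: "length b = n" "box E b" by auto
    have "0 \<notin> E" using assms by auto
    from word_code_surj[OF b(2) this] obtain u where u: "word_code u = b" "last_occ u = E"
      unfolding b(1) E by blast
    have "length u = n" using u(1) b(1) length_word_code[of u] by simp
    then have "pack u \<in> packed_words n" by (simp add: packed_words_def)
    then show "b \<in> word_code ` {u \<in> packed_words n. last_occ u = E}"
      using u by (intro image_eqI[of _ _ "pack u"]) simp_all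
  next
    fix b assume "b \<in> word_code ` {u \<in> packed_words n. last_occ u = E}"
    then obtain u where u: "b = word_code u" "length u = n" "last_occ u = E"
      by (auto simp: packed_words_def)
    then show "b \<in> {b. length b = n \<and> box E b}"
      using box_word_code[of u E] E by simp
  qed
qed

subsection \<open>Runs of the algorithm for LC\<close>

text \<open>The record of a run of the algorithm, latest step first: \<open>Inl j\<close> stands for a step with \<open>j \<le> card S\<close>,
  \<open>Inr s\<close> for a step that adds \<open>s\<close> to \<open>S\<close>.\<close>

definition marks :: "('a + nat) list \<Rightarrow> nat set" where
  "marks es = {s. Inr s \<in> set es}"

lemma marks_simps [simp]:
  "marks [] = {}" "marks (Inl j # es) = marks es" "marks (Inr s # es) = insert s (marks es)"
  by (auto simp: marks_def)

text \<open>The conditions do not mention E, so that one set of records serves all E. The bound on s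
  expresses the restriction imposed by \<open>box\<close>, which counts only elements up to the
  number of entries to the right.\<close>

fun valid_events :: "(nat + nat) list \<Rightarrow> bool" where
  "valid_events [] \<longleftrightarrow> True"
| "valid_events (Inl j # es) \<longleftrightarrow> j \<le> card (marks es) \<and> valid_events es"
| "valid_events (Inr s # es) \<longleftrightarrow> 1 \<le> s \<and> s \<le> length es \<and> s \<notin> marks es \<and> valid_events es"

text \<open>This undoes a run: an entry that led to adding s exceeded the size of S by the rank of s
  in E - S, where S is the set before that step.\<close>

fun event_code :: "nat set \<Rightarrow> (nat + nat) list \<Rightarrow> nat list" where
  "event_code E [] = []"
| "event_code E (Inl j # es) = j # event_code E es"
| "event_code E (Inr s # es) = (card (marks es) + card {x \<in> E - marks es. x \<le> s}) # event_code E es"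

lemma length_event_code [simp]: "length (event_code E es) = length es"
  by (induction E es rule: event_code.induct) auto

lemma marks_subset: "valid_events es \<Longrightarrow> marks es \<subseteq> {1..<length es}"
  by (induction es rule: valid_events.induct) fastforce+

lemma finite_marks [simp]: "finite (marks es)"
proof -
  have "marks es = Inr -` set es" by (auto simp: marks_def)
  then show ?thesis by (simp add: finite_vimageI)
qed

lemma card_rank_pos:
  "finite E \<Longrightarrow> s \<in> E \<Longrightarrow> 0 < card {x \<in> E. x \<le> (s::nat)}"
  by (auto simp: card_gt_0_iff)

lemma card_rank_less_iff:
  assumes "finite A" "s \<in> A" "t \<in> A"
  shows "card {x \<in> A. x \<le> s} < card {x \<in> A. x \<le> t} \<longleftrightarrow> s < (t::nat)"
  using strict_mono_on_less[OF strict_mono_on_rank[OF assms(1)] assms(2,3)] by simp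

text \<open>The marks and the unmarked elements up to s are disjoint subsets of the elements of E up
  to \<open>length es\<close>, whose number is the bound.\<close>

lemma box_event_code:
  assumes "finite E" "valid_events es" "marks es \<subseteq> E"
  shows "box E (event_code E es)"
  using assms(2,3)
proof (induction es rule: valid_events.induct)
  case (2 j es)
  have "marks es \<subseteq> {e \<in> E. e \<le> length es}" using 2 marks_subset[of es] by auto
  then have "card (marks es) \<le> card {e \<in> E. e \<le> length es}"
    using assms(1) by (intro card_mono) auto
  then show ?case using 2 by simp
next
  case (3 s es)
  have "card (marks es) + card {x \<in> E - marks es. x \<le> s} = card (marks es \<union> {x \<in> E - marks es. x \<le> s})"
    using assms(1) by (subst card_Un_disjoint) auto
  also have "\<dots> \<le> card {e \<in> E. e \<le> length es}"
    using assms(1) 3 marks_subset[of es] by (intro card_mono) auto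
  finally show ?case using 3 by simp
qed simp

lemma event_code_surj:
  assumes "finite E" "0 \<notin> E" "box E b"
  shows "\<exists>es. event_code E es = b \<and> valid_events es \<and> marks es \<subseteq> E"
  using assms(3)
proof (induction b)
  case Nil
  have "event_code E [] = [] \<and> valid_events [] \<and> marks [] \<subseteq> E" by simp
  then show ?case by blast
next
  case (Cons b bs)
  then obtain es where es: "event_code E es = bs" "valid_events es" "marks es \<subseteq> E" by auto
  have len: "length bs = length es" using es(1) length_event_code by metis
  show ?case
  proof (cases "b \<le> card (marks es)")
    case True
    then have "event_code E (Inl b # es) = b # bs \<and> valid_events (Inl b # es) \<and> marks (Inl b # es) \<subseteq> E"
      using es by simp
    then show ?thesis by blast
  next
    case False
    \<comment> \<open>All marks lie in the range that \<open>box\<close> counts, so at least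
      \<open>b - card (marks es)\<close> unmarked elements are left in it, and one of them has this
      rank.\<close>
    let ?A = "{x \<in> E - marks es. x \<le> length es}"
    have "{e \<in> E. e \<le> length es} = marks es \<union> ?A" using es marks_subset[of es] by auto
    then have "card {e \<in> E. e \<le> length es} = card (marks es) + card ?A"
      using assms(1) by (simp add: card_Un_disjoint disjoint_iff)
    then have "b - card (marks es) \<in> {1..card ?A}" using False Cons.prems len by auto
    also have "{1..card ?A} = (\<lambda>s. card {x \<in> ?A. x \<le> s}) ` ?A"
      using rank_image[of ?A] assms(1) by simp
    finally obtain s where s: "s \<in> ?A" "b - card (marks es) = card {x \<in> ?A. x \<le> s}" by blast
    moreover have "{x \<in> ?A. x \<le> s} = {x \<in> E - marks es. x \<le> s}" using s(1) by auto
    moreover have "1 \<le> s" using s(1) assms(2) by (cases s) auto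
    ultimately have "event_code E (Inr s # es) = b # bs \<and> valid_events (Inr s # es) \<and> marks (Inr s # es) \<subseteq> E"
      using es False by auto
    then show ?thesis by blast
  qed
qed

text \<open>Ranks are positive, so an entry exceeds the size of S exactly for an \<open>Inr\<close>
  step, and the rank then determines the element. The tails agree by induction, hence S is the same
  on both sides.\<close>

lemma event_code_inject:
  assumes "finite E" "event_code E es = event_code E fs"
    and "valid_events es" "marks es \<subseteq> E" "valid_events fs" "marks fs \<subseteq> E"
  shows "es = fs"
proof -
  have "length es = length fs" using assms(2) by (metis length_event_code)
  then show ?thesis using assms(2-)
  proof (induction es fs rule: list_induct2)
    case (Cons e es f fs)
    have "es = fs"
      using Cons by (cases e; cases f) auto
    have pos: "0 < card {x \<in> E - marks fs. x \<le> s}" if "s \<in> E - marks fs" for s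
      using card_rank_pos[of "E - marks fs" s] that assms(1) by simp
    show ?case
    proof (cases e)
      case (Inl i)
      then show ?thesis
        using Cons.prems pos \<open>es = fs\<close> by (cases f) force+
    next
      case e: (Inr s)
      then have s: "s \<in> E - marks fs" using Cons.prems \<open>es = fs\<close> by auto
      show ?thesis
      proof (cases f)
        case (Inl i)
        then show ?thesis using Cons.prems pos[OF s] e \<open>es = fs\<close> by auto
      next
        case f: (Inr t)
        then have t: "t \<in> E - marks fs" using Cons.prems \<open>es = fs\<close> by auto
        have "card {x \<in> E - marks fs. x \<le> s} = card {x \<in> E - marks fs. x \<le> t}"
          using Cons.prems e f \<open>es = fs\<close> by simp
        then have "s = t"
          using inj_onD[OF strict_mono_on_imp_inj_on[OF strict_mono_on_rank[of "E - marks fs"]] _ s t] assms(1)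
          by simp
        then show ?thesis using e f \<open>es = fs\<close> by simp
      qed
    qed
  qed simp
qed

lemma bij_betw_event_code:
  assumes "E \<subseteq> {1..<n}"
  shows "bij_betw (event_code E) {es. length es = n \<and> valid_events es \<and> marks es \<subseteq> E}
    {b. length b = n \<and> box E b}"
proof (rule bij_betw_imageI)
  have E: "finite E" "0 \<notin> E" using assms finite_subset by auto
  show "inj_on (event_code E) {es. length es = n \<and> valid_events es \<and> marks es \<subseteq> E}"
    using event_code_inject[OF E(1)] by (intro inj_onI) blast
  show "event_code E ` {es. length es = n \<and> valid_events es \<and> marks es \<subseteq> E}
      = {b. length b = n \<and> box E b}" (is "?L = ?R")
  proof (intro equalityI subsetI)
    fix b assume "b \<in> ?R"
    moreover from this obtain es where "event_code E es = b" "valid_events es" "marks es \<subseteq> E"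
      using event_code_surj[OF E] by blast
    ultimately show "b \<in> ?L" by force
  next
    fix b assume "b \<in> ?L"
    then show "b \<in> ?R" using box_event_code[OF E(1)] by auto
  qed
qed

text \<open>Consecutive events are compared in the order that puts every \<open>Inl\<close> below
  every \<open>Inr\<close> and is the usual one within each kind. E does not enter.\<close>

fun event_desc :: "(nat + nat) list \<Rightarrow> bool" where
  "event_desc (Inl i # Inl j # es) \<longleftrightarrow> j < i"
| "event_desc (Inl i # Inr t # es) \<longleftrightarrow> False"
| "event_desc (Inr s # Inl j # es) \<longleftrightarrow> True"
| "event_desc (Inr s # Inr t # es) \<longleftrightarrow> t < s"
| "event_desc _ \<longleftrightarrow> False"

text \<open>S grows by at most one element between the two entries. An \<open>Inl\<close> entry
  following an \<open>Inr\<close> step is at most the size of \<open>marks es\<close> plus one,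
  which the earlier entry reaches already; an \<open>Inr\<close> entry exceeds the size of S and so
  any \<open>Inl\<close> entry just before it.\<close>

lemma event_code_desc_iff:
  assumes "finite E" "valid_events (e # f # es)" "marks (e # f # es) \<subseteq> E"
  shows "hd (event_code E (f # es)) < hd (event_code E (e # f # es)) \<longleftrightarrow> event_desc (e # f # es)"
proof -
  let ?R = "marks es"
  have pos: "0 < card {x \<in> E - A. x \<le> s}" if "s \<in> E - A" for s A
    using card_rank_pos[of "E - A" s] that assms(1) by simp
  show ?thesis
  proof (cases e)
    case e: (Inl i)
    show ?thesis
    proof (cases f)
      case (Inr t)
      then show ?thesis using e assms pos[of t ?R] by auto
    qed (use e in auto)
  next
    case e: (Inr s)
    show ?thesis
    proof (cases f)
      case (Inl j)
      then show ?thesis using e assms pos[of s ?R] by auto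
    next
      case f: (Inr t)
      have t: "t \<in> E - ?R" and s: "s \<in> E - ?R" "s \<noteq> t" using e f assms by auto
      define r where "r = (\<lambda>s. card {x \<in> E - ?R. x \<le> s})"
      have r: "r t < r s \<longleftrightarrow> t < s" "r s < r t \<longleftrightarrow> s < t"
        using card_rank_less_iff[of "E - ?R"] s t assms(1) by (simp_all add: r_def)
      have "card (marks (f # es)) = Suc (card ?R)" using f t by simp
      \<comment> \<open>Marking t adds one to the size of S and takes one from the rank of each
        element above t. For s above t the effects cancel; for s below t the entry still does not
        exceed that of t.\<close>
      moreover have "card {x \<in> E - marks (f # es). x \<le> s} = (if t < s then r s - 1 else r s)"
      proof -
        have "{x \<in> E - marks (f # es). x \<le> s} = {x \<in> E - ?R. x \<le> s} - {t}"
          using f by auto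
        then show ?thesis using t s assms(1) by (simp add: r_def card_Diff_singleton_if)
      qed
      ultimately have "hd (event_code E (f # es)) < hd (event_code E (e # f # es)) \<longleftrightarrow>
          card ?R + r t < Suc (card ?R) + (if t < s then r s - 1 else r s)"
        using e f by (simp add: r_def)
      also have "\<dots> \<longleftrightarrow> t < s"
      proof (cases "t < s")
        case True
        then have "r t < r s" using r by simp
        then show ?thesis using True by simp
      next
        case False
        then have "r s < r t" using r s(2) by simp
        then show ?thesis using False by simp
      qed
      finally show ?thesis using e f by simp
    qed
  qed
qed

lemma event_code_eq_Nil [simp]: "event_code E es = [] \<longleftrightarrow> es = []"
  by (metis length_event_code length_0_conv)

lemma valid_events_ConsD: "valid_events (e # es) \<Longrightarrow> valid_events es"
  by (cases e) auto

lemma marks_Cons_subset: "marks es \<subseteq> marks (e # es)"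
  by (auto simp: marks_def)

lemma descs_event_code:
  assumes "finite E" "valid_events es" "marks es \<subseteq> E"
  shows "descs (event_code E es) = suffix_lengths event_desc es"
  using assms(2,3)
proof (induction es)
  case (Cons e es)
  have IH: "descs (event_code E es) = suffix_lengths event_desc es"
    using Cons valid_events_ConsD marks_Cons_subset by blast
  have eq: "event_code E (e # es) = hd (event_code E (e # es)) # event_code E es"
    by (cases e) auto
  have "hd (event_code E es) < hd (event_code E (e # es)) \<longleftrightarrow> event_desc (e # es)" if "es \<noteq> []"
    using that event_code_desc_iff[OF assms(1), of e "hd es" "tl es"] Cons.prems by simp
  then show ?case
    by (subst eq) (auto simp: suffix_lengths_Cons IH)
qed simp

text \<open>Only \<open>Inr\<close> steps depend on the ambient set. As the marks lie in E,
  enlarging E to F raises the rank of s by the number of elements of F - E up to s.\<close>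

lemma sum_event_code_mono:
  assumes "finite F" "E \<subseteq> F" "valid_events es" "marks es \<subseteq> E"
  shows "sum_list (event_code F es) = sum_list (event_code E es) + (\<Sum>s\<in>marks es. card {x \<in> F - E. x \<le> s})"
  using assms(3,4)
proof (induction es rule: valid_events.induct)
  case (3 s es)
  have "{x \<in> F - marks es. x \<le> s} = {x \<in> E - marks es. x \<le> s} \<union> {x \<in> F - E. x \<le> s}"
    using 3 assms(2) by auto
  moreover have "finite E" using assms finite_subset by blast
  ultimately have "card {x \<in> F - marks es. x \<le> s} = card {x \<in> E - marks es. x \<le> s} + card {x \<in> F - E. x \<le> s}"
    using assms(1) by (simp add: card_Un_disjoint disjoint_iff)
  then show ?case using 3 by simp
qed simp_all

section \<open>Replaying the algorithm for LC from a record\<close>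

lemma kth_smallest_rank:
  assumes "finite A" "s \<in> A"
  shows "kth_smallest A (card {x \<in> A. x \<le> s}) = s"
proof -
  let ?l = "sorted_list_of_set A"
  have sl: "sorted_wrt (<) ?l" "set ?l = A" "distinct ?l" using assms by auto
  then obtain i where i: "i < length ?l" "?l ! i = s" using assms(2) by (metis in_set_conv_nth)
  have less: "?l ! j < ?l ! k" if "j < k" "k < length ?l" for j k
    using sorted_wrt_nth_less[OF sl(1) that] .
  have "{x \<in> A. x \<le> s} = nth ?l ` {..i}"
  proof (intro equalityI subsetI)
    fix x assume x: "x \<in> {x \<in> A. x \<le> s}"
    then obtain j where j: "j < length ?l" "?l ! j = x" using sl(2) by (metis in_set_conv_nth mem_Collect_eq)
    then have "j \<le> i" using less[of i j] i x by (metis leD leI mem_Collect_eq)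
    then show "x \<in> nth ?l ` {..i}" using j by auto
  next
    fix x assume "x \<in> nth ?l ` {..i}"
    then obtain j where j: "j \<le> i" "x = ?l ! j" by auto
    have "x \<in> A" using j i nth_mem[of j ?l] sl(2) by simp
    moreover have "x \<le> s" using less[of j i] j i by (cases "j = i") auto
    ultimately show "x \<in> {x \<in> A. x \<le> s}" by simp
  qed
  moreover have "inj_on (nth ?l) {..i}"
    using sl(3) i by (intro inj_on_nth) auto
  \<comment> \<open>Index i counts from 0, the rank from 1; this is the shift by one in
    \<open>kth_smallest\<close>.\<close>
  ultimately have "card {x \<in> A. x \<le> s} = Suc i" by (simp add: card_image)
  then show ?thesis using i by (simp add: kth_smallest_def)
qed

lemma foldr_event_code_eq_marks:
  assumes "valid_events es" "length es \<le> n"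
  shows "foldr (\<lambda>c S. if card S < c then insert (kth_smallest ({1..n} - S) (c - card S)) S else S)
    (event_code {1..<n} es) {} = marks es"
  using assms
proof (induction es rule: valid_events.induct)
  case (3 s es)
  then have s: "s \<in> {1..<n} - marks es" by auto
  then have "0 < card {x \<in> {1..<n} - marks es. x \<le> s}" by (intro card_rank_pos) auto
  \<comment> \<open>LC selects in {1..n}, the code in {1..<n}; as s < n, the extra element n does
    not change the rank of s.\<close>
  moreover have "{x \<in> {1..<n} - marks es. x \<le> s} = {x \<in> {1..n} - marks es. x \<le> s}" using s by auto
  moreover have "kth_smallest ({1..n} - marks es) (card {x \<in> {1..n} - marks es. x \<le> s}) = s"
    using s by (intro kth_smallest_rank) auto
  ultimately show ?case using 3 by simp
qed auto

subsection \<open>Descents and the products of complete functions\<close>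

lemma reflect_reflect:
  fixes n :: nat
  assumes "A \<subseteq> {1..<n}"
  shows "(\<lambda>e. n - e) ` (\<lambda>e. n - e) ` A = A"
proof -
  have "(\<lambda>e. n - e) ` (\<lambda>e. n - e) ` A = (\<lambda>e. e) ` A"
    unfolding image_image using assms by (intro image_cong) auto
  then show ?thesis by simp
qed

lemma reflect_subset:
  fixes n :: nat
  assumes "A \<subseteq> {1..<n}"
  shows "(\<lambda>e. n - e) ` A \<subseteq> {1..<n}"
proof (rule image_subsetI)
  fix e assume "e \<in> A"
  then have "1 \<le> e" "e < n" using assms by auto
  then show "n - e \<in> {1..<n}" by simp
qed

text \<open>A position p counted from 1 has e = n - p letters after it, and its letter is the head
  of \<open>drop (p - 1) u\<close>.\<close>

lemma WC_eq_iff: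
  assumes "length u = n" "is_comp n K"
  shows "WC u = K \<longleftrightarrow> last_occ u = (\<lambda>d. n - d) ` Des K"
proof -
  have "{p \<in> {1..<n}. u ! (p - 1) \<notin> set (drop p u)}
      = {p \<in> {1..<n}. hd (drop (p - 1) u) \<notin> set (tl (drop (p - 1) u))}"
  proof (intro Collect_cong conj_cong refl)
    fix p assume "p \<in> {1..<n}"
    then have "1 \<le> p" "p < n" by auto
    then show "(u ! (p - 1) \<notin> set (drop p u)) = (hd (drop (p - 1) u) \<notin> set (tl (drop (p - 1) u)))"
      using assms(1) by (simp add: hd_drop_conv_nth tl_drop drop_Suc[symmetric])
  qed
  also have "\<dots> = (\<lambda>e. n - e) ` last_occ u"
    using reflect_suffix_lengths[of u "\<lambda>s. hd s \<notin> set (tl s)"] assms(1) by simp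
  finally have S: "{p \<in> {1..<n}. u ! (p - 1) \<notin> set (drop p u)} = (\<lambda>e. n - e) ` last_occ u" .
  have sub: "last_occ u \<subseteq> {1..<n}" using suffix_lengths_subset assms(1) by blast
  have "WC u = K \<longleftrightarrow> Des K = (\<lambda>e. n - e) ` last_occ u"
    using comp_of_des_eq_iff[OF reflect_subset[OF sub] assms(2)] S assms(1) by (simp add: WC_def)
  also have "\<dots> \<longleftrightarrow> last_occ u = (\<lambda>d. n - d) ` Des K"
    using reflect_reflect[OF sub] reflect_reflect[OF Des_subset[OF assms(2)]] by metis
  finally show ?thesis .
qed

lemma reflect_descs: "(\<lambda>e. length u - e) ` descs u = {p \<in> {1..<length u}. u ! p < u ! (p - 1)}"
proof -
  have "{p \<in> {1..<length u}. u ! p < u ! (p - 1)}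
      = {p \<in> {1..<length u}. hd (tl (drop (p - 1) u)) < hd (drop (p - 1) u)}"
  proof (intro Collect_cong conj_cong refl)
    fix p assume "p \<in> {1..<length u}"
    then have "1 \<le> p" "p < length u" by auto
    then show "(u ! p < u ! (p - 1)) = (hd (tl (drop (p - 1) u)) < hd (drop (p - 1) u))"
      by (simp add: hd_drop_conv_nth tl_drop drop_Suc[symmetric])
  qed
  then show ?thesis
    using reflect_suffix_lengths[of u "\<lambda>s. hd (tl s) < hd s"] by simp
qed

text \<open>For a composition J and a word of its total length, this says that the word is
  nondecreasing on the consecutive blocks whose lengths are the parts of J.\<close>

definition descs_at :: "nat list \<Rightarrow> nat list \<Rightarrow> bool" where
  "descs_at J u \<longleftrightarrow> (\<lambda>e. length u - e) ` descs u \<subseteq> Des J"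

lemma descs_at_pack [simp]: "descs_at J (pack u) = descs_at J u"
  by (simp add: descs_at_def)

lemma sorted_iff_descs: "sorted u \<longleftrightarrow> descs u = {}"
proof -
  have "descs u = {} \<longleftrightarrow> (\<forall>p \<in> {1..<length u}. u ! (p - 1) \<le> u ! p)"
  proof -
    have "descs u = {} \<longleftrightarrow> (\<lambda>e. length u - e) ` descs u = {}" by simp
    then show ?thesis unfolding reflect_descs by (auto simp: not_less)
  qed
  also have "\<dots> \<longleftrightarrow> (\<forall>i. Suc i < length u \<longrightarrow> u ! i \<le> u ! Suc i)"
  proof safe
    fix i assume "\<forall>p \<in> {1..<length u}. u ! (p - 1) \<le> u ! p" "Suc i < length u"
    then show "u ! i \<le> u ! Suc i" by (auto dest: bspec[of _ _ "Suc i"])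
  next
    fix p assume "\<forall>i. Suc i < length u \<longrightarrow> u ! i \<le> u ! Suc i" "p \<in> {1..<length u}"
    then show "u ! (p - 1) \<le> u ! p" by (cases p) auto
  qed
  finally show ?thesis by (simp add: sorted_iff_nth_Suc)
qed

lemma sorted_pack [simp]: "sorted (pack u) = sorted u"
  by (simp add: sorted_iff_descs)

lemma Des_Cons: "Des (j # J) = (if J = [] then {} else insert j ((+) j ` Des J))"
proof -
  have "{0<..<length (j # J)} = (if J = [] then {} else insert 1 (Suc ` {0<..<length J}))"
  proof (cases "J = []")
    case False
    have "k \<in> insert 1 (Suc ` {0<..<length J})" if "k \<in> {0<..<length (j # J)}" for k
      using that by (cases k) (auto simp: image_iff)
    then have "{0<..<length (j # J)} \<subseteq> insert 1 (Suc ` {0<..<length J})" by blast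
    moreover have "insert 1 (Suc ` {0<..<length J}) \<subseteq> {0<..<length (j # J)}" using False by auto
    ultimately show ?thesis using False by (simp only: if_False)
  qed auto
  then show ?thesis by (auto simp: Des_image image_image)
qed

text \<open>A descent before j breaks the first block, one at j is free, and one beyond j is a
  descent of the remaining word, shifted by j.\<close>

lemma descs_at_Cons:
  assumes "length u = j + sum_list J" "0 < j" "\<forall>x\<in>set J. 0 < x"
  shows "descs_at (j # J) u \<longleftrightarrow> sorted (take j u) \<and> descs_at J (drop j u)"
proof -
  have J: "Des J \<subseteq> {1..<sum_list J}" using assms(3) by (intro Des_subset) (simp add: is_comp_def)
  let ?P = "\<lambda>p. 1 \<le> p \<and> p < length u \<and> u ! p < u ! (p - 1)"
  have 1: "descs_at (j # J) u \<longleftrightarrow> (\<forall>p. ?P p \<longrightarrow> p \<in> Des (j # J))"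
    unfolding descs_at_def reflect_descs by auto
  have "descs_at J (drop j u) \<longleftrightarrow> (\<forall>p. 1 \<le> p \<and> p < length u - j \<and> u ! (j + p) < u ! (j + (p - 1)) \<longrightarrow> p \<in> Des J)"
    unfolding descs_at_def reflect_descs using assms(1) by auto
  also have "\<dots> \<longleftrightarrow> (\<forall>p. ?P p \<and> j < p \<longrightarrow> p - j \<in> Des J)"
  proof safe
    fix p assume h: "\<forall>p. 1 \<le> p \<and> p < length u - j \<and> u ! (j + p) < u ! (j + (p - 1)) \<longrightarrow> p \<in> Des J"
      "1 \<le> p" "j < p" "p < length u" "u ! p < u ! (p - 1)"
    have "j + (p - j) = p" "j + (p - j - 1) = p - 1" using h by auto
    then show "p - j \<in> Des J" using h by (metis One_nat_def Suc_leI diff_less_mono less_imp_le zero_less_diff)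
  next
    fix p assume h: "\<forall>p. ?P p \<and> j < p \<longrightarrow> p - j \<in> Des J"
      "1 \<le> p" "p < length u - j" "u ! (j + p) < u ! (j + (p - 1))"
    then have "?P (j + p) \<and> j < j + p" by auto
    then show "p \<in> Des J" using h(1) by fastforce
  qed
  finally have 2: "descs_at J (drop j u) \<longleftrightarrow> (\<forall>p. ?P p \<and> j < p \<longrightarrow> p - j \<in> Des J)" .
  have "sorted (take j u) \<longleftrightarrow> (\<forall>i. Suc i < j \<longrightarrow> u ! i \<le> u ! Suc i)"
    using assms(1) by (auto simp: sorted_iff_nth_Suc)
  also have "\<dots> \<longleftrightarrow> (\<forall>p. \<not> (?P p \<and> p < j))"
  proof safe
    fix p assume "\<forall>i. Suc i < j \<longrightarrow> u ! i \<le> u ! Suc i" "1 \<le> p" "p < j" "u ! p < u ! (p - 1)"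
    then show False by (cases p) (auto simp: not_less[symmetric])
  next
    fix i assume h: "\<forall>p. \<not> (?P p \<and> p < j)" "Suc i < j"
    then have "\<not> ?P (Suc i)" by blast
    then show "u ! i \<le> u ! Suc i" using h assms(1) by simp
  qed
  finally have 3: "sorted (take j u) \<longleftrightarrow> (\<forall>p. \<not> (?P p \<and> p < j))" .
  have 4: "p \<in> Des (j # J) \<longleftrightarrow> \<not> p < j \<and> (j < p \<longrightarrow> p - j \<in> Des J)" if "?P p" for p
  proof (cases "J = []")
    case True
    then show ?thesis using that assms(1) by (simp add: Des_Cons)
  next
    case False
    have "p \<in> (+) j ` Des J \<longleftrightarrow> j < p \<and> p - j \<in> Des J"
      using J by (auto simp: image_iff intro!: bexI[of _ "p - j"])
    then show ?thesis using False by (auto simp: Des_Cons)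
  qed
  show ?thesis unfolding 1 2 3 using 4 by blast
qed

section \<open>Expansion of the q-deformed products\<close>

lemma qvar_nonzero [simp]: "(qvar :: 'k::field_char_0 poly fract) \<noteq> 0"
  by (simp add: qvar_def Zero_fract_def eq_fract)

lemma sinv_sorted: "sorted u \<Longrightarrow> sinv u = 0"
proof (induction u)
  case (Cons x xs)
  then have "{v \<in> set xs. v < x} = {}" by (auto simp: not_less)
  then show ?case using Cons by (simp only: sinv_Cons) simp
qed (simp add: sinv_def)

text \<open>In each product only the cut after j letters survives. The sorted prefix has
  \<open>sinv\<close> 0, so the twist supplies exactly what \<open>sinv u\<close> has beyond the
  \<open>sinv\<close> of the suffix, and the powers of q telescope.\<close>

lemma foldr_qstar_Stilde:
  assumes "\<forall>x\<in>set J. 0 < x"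
  shows "foldr qstar (map Stilde J) wq_one u =
    (if packed u \<and> length u = sum_list J \<and> descs_at J u
     then (qvar :: 'k::field_char_0 poly fract) ^ sinv u else 0)"
  using assms
proof (induction J arbitrary: u)
  case Nil
  have "descs_at [] []" "packed []" "sinv [] = 0" by (auto simp: descs_at_def packed_def sinv_def)
  then show ?case by (auto simp: wq_one_def)
next
  case (Cons j J)
  define G where "G = (foldr qstar (map Stilde J) wq_one :: 'k poly fract wqsym)"
  have G: "G v = (if packed v \<and> length v = sum_list J \<and> descs_at J v then qvar ^ sinv v else 0)" for v
    unfolding G_def using Cons by simp
  show ?case
  proof (cases "packed u \<and> j \<le> length u")
    case False
    then have "qstar (Stilde j) G u = 0"
      by (auto simp: qstar_def Stilde_def intro!: sum.neutral)
    then show ?thesis using False by (auto simp: G_def)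
  next
    case True
    let ?h = "\<lambda>k. Stilde j (pack (take k u)) * G (pack (drop k u)) *
      qvar powi (int (sinv u) - int (sinv (pack (take k u))) - int (sinv (pack (drop k u))))"
    have "qstar (Stilde j) G u = (\<Sum>k\<in>{0..length u}. ?h k)"
      using True by (simp add: qstar_def)
    also have "\<dots> = (\<Sum>k\<in>{j}. ?h k)"
      using True by (intro sum.mono_neutral_right) (auto simp: Stilde_def)
    finally have q: "qstar (Stilde j) G u = ?h j" by simp
    show ?thesis
    proof (cases "length u = j + sum_list J \<and> sorted (take j u) \<and> descs_at J (drop j u)")
      case t: True
      have "sinv (take j u) = 0" using t sinv_sorted by blast
      then have "?h j = qvar ^ sinv (drop j u) * qvar powi (int (sinv u) - int (sinv (drop j u)))"
        using t by (simp add: G Stilde_def)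
      also have "\<dots> = qvar ^ sinv u"
        by (simp add: power_int_diff)
      finally show ?thesis
        using t q True descs_at_Cons[of u j J] Cons.prems by (simp add: G_def)
    next
      case f: False
      have "?h j = 0" using f True by (auto simp: G Stilde_def)
      moreover have "\<not> (length u = sum_list (j # J) \<and> descs_at (j # J) u)"
        using f descs_at_Cons[of u j J] Cons.prems by auto
      ultimately show ?thesis using q by (auto simp: G_def)
    qed
  qed
qed

lemma finite_packed_words [simp]: "finite (packed_words n)"
proof (rule finite_subset)
  show "packed_words n \<subseteq> {u. set u \<subseteq> {1..n} \<and> length u = n}"
  proof
    fix u assume "u \<in> packed_words n"
    then have "set u = {1..card (set u)}" "length u = n" by (auto simp: packed_words_def packed_def)
    moreover have "card (set u) \<le> length u" by (rule card_length)
    ultimately have "set u \<subseteq> {1..n}" by fastforce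
    then show "u \<in> {u. set u \<subseteq> {1..n} \<and> length u = n}" using \<open>length u = n\<close> by simp
  qed
  show "finite {u. set u \<subseteq> {1..n} \<and> length u = n}" by (rule finite_lists_length_eq) simp
qed

lemma SJ_eq_sum_words:
  assumes "is_comp n J" "is_comp n K"
  shows "SJ J K = (\<Sum>u\<in>{u \<in> packed_words n. last_occ u = (\<lambda>d. n - d) ` Des K \<and> descs_at J u}.
    (qvar :: 'k::field_char_0 poly fract) ^ sinv u)"
proof -
  have n: "sum_list J = n" and pos: "\<forall>x\<in>set J. 0 < x" using assms(1) by (auto simp: is_comp_def)
  have "SJ J K = (\<Sum>u\<in>{u \<in> packed_words n. WC u = K}.
      if descs_at J u then (qvar :: 'k poly fract) ^ sinv u else 0)"
    unfolding SJ_def zeta_def n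
    by (intro sum.cong refl) (auto simp: foldr_qstar_Stilde[OF pos] n packed_words_def)
  also have "\<dots> = (\<Sum>u\<in>{u \<in> {u \<in> packed_words n. WC u = K}. descs_at J u}. qvar ^ sinv u)"
    by (intro sum.inter_filter[symmetric]) simp
  also have "{u \<in> {u \<in> packed_words n. WC u = K}. descs_at J u}
      = {u \<in> packed_words n. last_occ u = (\<lambda>d. n - d) ` Des K \<and> descs_at J u}"
    using WC_eq_iff[OF _ assms(2)] by (auto simp: packed_words_def)
  finally show ?thesis .
qed

lemma bij_betw_filter:
  assumes "bij_betw f A B" "\<And>x. x \<in> A \<Longrightarrow> P x \<longleftrightarrow> Q (f x)"
  shows "bij_betw f {x \<in> A. P x} {y \<in> B. Q y}"
  using assms unfolding bij_betw_def inj_on_def by auto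

text \<open>The sequences bounded by \<open>box E\<close> are the common image of the words under
  \<open>word_code\<close> and of the records under \<open>event_code E\<close>. Both maps turn the
  statistic into the sum of the entries and keep track of descents.\<close>

lemma SJ_eq_sum_events:
  assumes "is_comp n J" "is_comp n K"
  defines "E \<equiv> (\<lambda>d. n - d) ` Des K"
  shows "SJ J K = (\<Sum>es\<in>{es. length es = n \<and> valid_events es \<and> marks es \<subseteq> E \<and>
      (\<lambda>e. n - e) ` suffix_lengths event_desc es \<subseteq> Des J}.
    (qvar :: 'k::field_char_0 poly fract) ^ sum_list (event_code E es))"
proof -
  have E: "E \<subseteq> {1..<n}" unfolding E_def using reflect_subset Des_subset[OF assms(2)] by blast
  then have fin: "finite E" using finite_subset by blast
  let ?C = "{b \<in> {b. length b = n \<and> box E b}. (\<lambda>e. n - e) ` descs b \<subseteq> Des J}"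
  have w: "bij_betw word_code {u \<in> {u \<in> packed_words n. last_occ u = E}. descs_at J u} ?C"
    by (rule bij_betw_filter[OF bij_betw_word_code[OF E]]) (simp add: descs_at_def packed_words_def)
  have e: "bij_betw (event_code E) {es \<in> {es. length es = n \<and> valid_events es \<and> marks es \<subseteq> E}.
      (\<lambda>e. n - e) ` suffix_lengths event_desc es \<subseteq> Des J} ?C"
    by (rule bij_betw_filter[OF bij_betw_event_code[OF E]]) (simp add: descs_event_code fin)
  have "SJ J K = (\<Sum>u\<in>{u \<in> {u \<in> packed_words n. last_occ u = E}. descs_at J u}.
      (qvar :: 'k poly fract) ^ sum_list (word_code u))"
    unfolding SJ_eq_sum_words[OF assms(1,2)]
    by (intro sum.cong) (auto simp: E_def sinv_eq_sum_word_code)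
  also have "\<dots> = (\<Sum>b\<in>?C. qvar ^ sum_list b)"
    by (rule sum.reindex_bij_betw[OF w])
  also have "\<dots> = (\<Sum>es\<in>{es \<in> {es. length es = n \<and> valid_events es \<and> marks es \<subseteq> E}.
      (\<lambda>e. n - e) ` suffix_lengths event_desc es \<subseteq> Des J}. qvar ^ sum_list (event_code E es))"
    by (rule sum.reindex_bij_betw[OF e, symmetric])
  finally show ?thesis by (simp add: conj_assoc)
qed

subsection \<open>Permutations\<close>

lemma last_occ_eq_iff_distinct: "last_occ u = {1..<length u} \<longleftrightarrow> distinct u"
proof (cases "u = []")
  case False
  have "last_occ u = {1..<length u} \<longleftrightarrow> card (last_occ u) = length u - 1"
    using card_subset_eq[OF _ suffix_lengths_subset, of u] by auto
  also have "\<dots> \<longleftrightarrow> card (set u) = length u"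
    using False card_set_eq_last_occ[OF False] by (cases u) auto
  finally show ?thesis using card_distinct distinct_card by blast
qed simp

text \<open>Passing to the inverse turns recoils into descents and the numbers \<open>lc_c\<close>
  into the entries of \<open>word_code\<close>.\<close>

definition inverse_word :: "nat \<Rightarrow> (nat \<Rightarrow> nat) \<Rightarrow> nat list" where
  "inverse_word n \<sigma> = map (inv \<sigma>) [1..<n+1]"

lemma length_inverse_word [simp]: "length (inverse_word n \<sigma>) = n"
  by (simp add: inverse_word_def)

lemma inverse_word_nth: "i < n \<Longrightarrow> inverse_word n \<sigma> ! i = inv \<sigma> (Suc i)"
  by (simp add: inverse_word_def del: upt_Suc)

lemma bij_betw_inverse_word:
  "bij_betw (inverse_word n) {\<sigma>. \<sigma> permutes {1..n}} {u \<in> packed_words n. last_occ u = {1..<n}}"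
proof (rule bij_betw_imageI)
  show "inj_on (inverse_word n) {\<sigma>. \<sigma> permutes {1..n}}"
  proof (rule inj_onI)
    fix \<sigma> \<tau> assume "\<sigma> \<in> {\<sigma>. \<sigma> permutes {1..n}}" "\<tau> \<in> {\<sigma>. \<sigma> permutes {1..n}}"
      and eq: "inverse_word n \<sigma> = inverse_word n \<tau>"
    then have p: "\<sigma> permutes {1..n}" "\<tau> permutes {1..n}" by auto
    have "inv \<sigma> i = inv \<tau> i" for i
    proof (cases "i \<in> {1..n}")
      case True
      then have "i \<in> set [1..<n+1]" by auto
      then show ?thesis using eq unfolding inverse_word_def map_eq_conv by blast
    next
      case False
      then show ?thesis using permutes_inv[OF p(1)] permutes_inv[OF p(2)] by (simp add: permutes_def)
    qed
    then have "inv (inv \<sigma>) = inv (inv \<tau>)" by presburger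
    then show "\<sigma> = \<tau>" using p by (simp add: permutes_inv_inv)
  qed
  show "inverse_word n ` {\<sigma>. \<sigma> permutes {1..n}} = {u \<in> packed_words n. last_occ u = {1..<n}}"
  proof (intro equalityI subsetI)
    fix u assume "u \<in> inverse_word n ` {\<sigma>. \<sigma> permutes {1..n}}"
    then obtain \<sigma> where s: "\<sigma> permutes {1..n}" "u = inverse_word n \<sigma>" by auto
    have s': "inv \<sigma> permutes {1..n}" using s(1) by (rule permutes_inv)
    have "set u = inv \<sigma> ` {1..n}" using s(2) by (auto simp: inverse_word_def)
    then have "set u = {1..n}" using permutes_image[OF s'] by simp
    then have "packed u" by (simp add: packed_def)
    moreover have "distinct u"
      unfolding s(2) inverse_word_def distinct_map using permutes_inj_on[OF s'] by simp
    ultimately show "u \<in> {u \<in> packed_words n. last_occ u = {1..<n}}"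
      using last_occ_eq_iff_distinct[of u] s(2) by (simp add: packed_words_def)
  next
    fix u assume u: "u \<in> {u \<in> packed_words n. last_occ u = {1..<n}}"
    then have len: "length u = n" and "packed u" and d: "distinct u"
      using last_occ_eq_iff_distinct[of u] by (auto simp: packed_words_def)
    then have set: "set u = {1..n}" using distinct_card[OF d] by (simp add: packed_def)
    define \<tau> where "\<tau> = (\<lambda>i. if i \<in> {1..n} then u ! (i - 1) else i)"
    have "\<tau> permutes {1..n}"
    proof (rule bij_imp_permutes)
      show "bij_betw \<tau> {1..n} {1..n}"
      proof (rule bij_betw_imageI)
        show inj: "inj_on \<tau> {1..n}"
        proof (rule inj_onI)
          fix i j assume "i \<in> {1..n}" "j \<in> {1..n}" "\<tau> i = \<tau> j"
          then have "i - 1 = j - 1"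
            using nth_eq_iff_index_eq[OF d, of "i - 1" "j - 1"] len by (auto simp: \<tau>_def)
          then show "i = j" using \<open>i \<in> _\<close> \<open>j \<in> _\<close> by auto
        qed
        have "\<tau> ` {1..n} \<subseteq> set u" using len by (auto simp: \<tau>_def)
        then have "\<tau> ` {1..n} \<subseteq> {1..n}" using set by simp
        then show "\<tau> ` {1..n} = {1..n}"
          using inj by (intro endo_inj_surj) auto
      qed
    qed (auto simp: \<tau>_def)
    moreover have "inverse_word n (inv \<tau>) = u"
    proof (rule nth_equalityI)
      fix i assume "i < length (inverse_word n (inv \<tau>))"
      then have "i < n" by simp
      then show "inverse_word n (inv \<tau>) ! i = u ! i"
        using \<open>\<tau> permutes {1..n}\<close> by (simp add: inverse_word_nth permutes_inv_inv) (simp add: \<tau>_def)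
    qed (simp add: len)
    ultimately show "u \<in> inverse_word n ` {\<sigma>. \<sigma> permutes {1..n}}"
      using permutes_inv by (intro image_eqI[of _ _ "inv \<tau>"]) auto
  qed
qed

lemma word_code_map_upt:
  "word_code (map f [a..<b]) = map (\<lambda>i. card {v \<in> f ` {i<..<b}. v < f i}) [a..<b]"
proof (induction "b - a" arbitrary: a)
  case (Suc k)
  then have "a < b" by simp
  moreover have "{Suc a..<b} = {a<..<b}" by auto
  ultimately show ?case using Suc by (simp add: upt_conv_Cons)
qed simp

lemma word_code_inverse_word:
  assumes "\<sigma> permutes {1..n}"
  shows "word_code (inverse_word n \<sigma>) = map (lc_c n \<sigma>) [1..<n+1]"
proof -
  have inj: "inj (inv \<sigma>)" using permutes_inj[OF permutes_inv[OF assms]] .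
  have "card {v \<in> inv \<sigma> ` {i<..<n+1}. v < inv \<sigma> i} = lc_c n \<sigma> i" for i
  proof -
    have "{v \<in> inv \<sigma> ` {i<..<n+1}. v < inv \<sigma> i} = inv \<sigma> ` {j \<in> {1..n}. i < j \<and> inv \<sigma> j < inv \<sigma> i}"
      by auto
    then show ?thesis
      unfolding lc_c_def using card_image[OF inj_on_subset[OF inj subset_UNIV]] by simp
  qed
  then show ?thesis unfolding inverse_word_def word_code_map_upt by simp
qed

lemma inv_count_eq_sum_word_code:
  assumes "\<sigma> permutes {1..n}"
  shows "inv_count n \<sigma> = sum_list (word_code (inverse_word n \<sigma>))"
proof -
  let ?A = "{(i, j). i \<in> {1..n} \<and> j \<in> {1..n} \<and> i < j \<and> \<sigma> j < \<sigma> i}"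
  let ?B = "Sigma {1..n} (\<lambda>t. {j \<in> {1..n}. t < j \<and> inv \<sigma> j < inv \<sigma> t})"
  have in1: "\<sigma> i \<in> {1..n} \<longleftrightarrow> i \<in> {1..n}" and in2: "inv \<sigma> i \<in> {1..n} \<longleftrightarrow> i \<in> {1..n}"
    and c: "\<sigma> (inv \<sigma> i) = i" "inv \<sigma> (\<sigma> i) = i" for i
    using permutes_in_image[OF assms] permutes_in_image[OF permutes_inv[OF assms]]
      permutes_inverses[OF assms] by auto
  \<comment> \<open>An inversion of \<sigma> at positions i < j gives the values \<sigma> j <
    \<sigma> i, which form an inversion of the inverse.\<close>
  have "bij_betw (\<lambda>(i, j). (\<sigma> j, \<sigma> i)) ?A ?B"
  proof (rule bij_betw_byWitness[where f' = "\<lambda>(a, b). (inv \<sigma> b, inv \<sigma> a)"])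
    show "(\<lambda>(i, j). (\<sigma> j, \<sigma> i)) ` ?A \<subseteq> ?B"
      using in1 by (auto simp: c simp del: atLeastAtMost_iff)
    show "(\<lambda>(a, b). (inv \<sigma> b, inv \<sigma> a)) ` ?B \<subseteq> ?A"
      using in2 by (auto simp: c simp del: atLeastAtMost_iff)
  qed (auto simp: c)
  then have "inv_count n \<sigma> = card ?B" unfolding inv_count_def by (rule bij_betw_same_card)
  also have "\<dots> = (\<Sum>t\<in>{1..n}. lc_c n \<sigma> t)" by (simp add: lc_c_def)
  also have "\<dots> = sum_list (map (lc_c n \<sigma>) [1..<n+1])"
    by (simp add: interv_sum_list_conv_sum_set_nat atLeastLessThanSuc_atLeastAtMost del: upt_Suc)
  finally show ?thesis using word_code_inverse_word[OF assms] by simp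
qed

lemma Des_recoil: "Des (recoil n \<sigma>) = (\<lambda>e. n - e) ` descs (inverse_word n \<sigma>)"
proof -
  have "(\<lambda>e. n - e) ` descs (inverse_word n \<sigma>)
      = {p \<in> {1..<n}. inverse_word n \<sigma> ! p < inverse_word n \<sigma> ! (p - 1)}"
    using reflect_descs[of "inverse_word n \<sigma>"] by simp
  also have "\<dots> = {i \<in> {1..<n}. inv \<sigma> (i + 1) < inv \<sigma> i}"
    by (intro Collect_cong conj_cong refl) (auto simp: inverse_word_nth)
  finally show ?thesis
    unfolding recoil_def by (subst Des_comp_of_des) auto
qed

lemma LC_set_eq_marks:
  assumes "\<sigma> permutes {1..n}" "valid_events es"
    and "word_code (inverse_word n \<sigma>) = event_code {1..<n} es"
  shows "LC_set n \<sigma> = marks es"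
proof -
  have len: "length es = n"
    using arg_cong[OF assms(3), of length] by simp
  let ?G = "\<lambda>c S. if card S < c then insert (kth_smallest ({1..n} - S) (c - card S)) S else S"
  \<comment> \<open>Folding from the right treats the letters from n down to 1, the order in which a
    record grows at its head.\<close>
  have "LC_set n \<sigma> = foldr (\<lambda>t. ?G (lc_c n \<sigma> t)) [1..<n+1] {}"
    unfolding LC_set_def foldl_conv_foldr rev_rev_ident ..
  also have "\<dots> = foldr ?G (event_code {1..<n} es) {}"
    using assms(3) unfolding word_code_inverse_word[OF assms(1)]
    by (metis (no_types, lifting) foldr_map comp_def foldr_cong)
  also have "\<dots> = marks es"
    using foldr_event_code_eq_marks[OF assms(2)] len by simp
  finally show ?thesis .
qed

lemma sum_PP_eq_sum_events:
  assumes "is_comp n I"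
  shows "(\<Sum>\<sigma>\<in>PP n I J. x ^ inv_count n \<sigma>) =
    (\<Sum>es\<in>{es. length es = n \<and> valid_events es \<and> marks es = (\<lambda>d. n - d) ` Des I \<and>
      (\<lambda>e. n - e) ` suffix_lengths event_desc es \<subseteq> Des J}.
    (x :: 'a :: comm_semiring_1) ^ sum_list (event_code {1..<n} es))"
proof -
  let ?P = "{\<sigma>. \<sigma> permutes {1..n}}" and ?Ev = "{es. length es = n \<and> valid_events es \<and> marks es \<subseteq> {1..<n}}"
  define code where "code = (\<lambda>\<sigma>. word_code (inverse_word n \<sigma>))"
  define events where "events = (\<lambda>\<sigma>. the_inv_into ?Ev (event_code {1..<n}) (code \<sigma>))"
  have 1: "bij_betw code ?P {b. length b = n \<and> box {1..<n} b}"
    using bij_betw_trans[OF bij_betw_inverse_word bij_betw_word_code[of "{1..<n}" n]]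
    by (simp add: code_def comp_def)
  have 2: "bij_betw (event_code {1..<n}) ?Ev {b. length b = n \<and> box {1..<n} b}"
    by (rule bij_betw_event_code) simp
  have ev: "bij_betw events ?P ?Ev"
    using bij_betw_trans[OF 1 bij_betw_the_inv_into[OF 2]] by (simp add: events_def comp_def)
  have code: "event_code {1..<n} (events \<sigma>) = code \<sigma>" if "\<sigma> \<in> ?P" for \<sigma>
    unfolding events_def using f_the_inv_into_f_bij_betw[OF 2] bij_betw_apply[OF 1 that] by blast
  let ?Q = "\<lambda>es. marks es = (\<lambda>d. n - d) ` Des I \<and> (\<lambda>e. n - e) ` suffix_lengths event_desc es \<subseteq> Des J"
  have "(LC n \<sigma> = I \<and> Des (recoil n \<sigma>) \<subseteq> Des J) \<longleftrightarrow> ?Q (events \<sigma>)" if s: "\<sigma> \<in> ?P" for \<sigma>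
  proof -
    have es: "valid_events (events \<sigma>)" "marks (events \<sigma>) \<subseteq> {1..<n}"
      using bij_betw_apply[OF ev s] by auto
    have S: "LC_set n \<sigma> = marks (events \<sigma>)"
      using LC_set_eq_marks[of \<sigma> n "events \<sigma>"] es s code[OF s] by (simp add: code_def)
    \<comment> \<open>LC reverses the composition, so the final S has to be the descent set of
      \<open>rev I\<close>, which is the reflected \<open>Des I\<close>.\<close>
    have "LC n \<sigma> = I \<longleftrightarrow> comp_of_des n (LC_set n \<sigma>) = rev I"
      unfolding LC_def by (metis rev_rev_ident)
    also have "\<dots> \<longleftrightarrow> Des (rev I) = marks (events \<sigma>)"
      unfolding S by (rule comp_of_des_eq_iff) (use es assms in simp_all)
    finally have "LC n \<sigma> = I \<longleftrightarrow> marks (events \<sigma>) = (\<lambda>d. n - d) ` Des I"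
      using Des_rev[OF assms] by metis
    moreover have "descs (inverse_word n \<sigma>) = suffix_lengths event_desc (events \<sigma>)"
      using descs_event_code[of "{1..<n}", OF _ es] code[OF s] by (simp add: code_def)
    ultimately show ?thesis by (simp add: Des_recoil)
  qed
  then have "bij_betw events {\<sigma> \<in> ?P. LC n \<sigma> = I \<and> Des (recoil n \<sigma>) \<subseteq> Des J} {es \<in> ?Ev. ?Q es}"
    by (rule bij_betw_filter[OF ev])
  moreover have "PP n I J = {\<sigma> \<in> ?P. LC n \<sigma> = I \<and> Des (recoil n \<sigma>) \<subseteq> Des J}"
    by (auto simp: PP_def)
  moreover have "{es \<in> ?Ev. ?Q es} = {es. length es = n \<and> valid_events es \<and>
      marks es = (\<lambda>d. n - d) ` Des I \<and> (\<lambda>e. n - e) ` suffix_lengths event_desc es \<subseteq> Des J}"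
    using marks_subset by blast
  ultimately have b: "bij_betw events (PP n I J) {es. length es = n \<and> valid_events es \<and>
      marks es = (\<lambda>d. n - d) ` Des I \<and> (\<lambda>e. n - e) ` suffix_lengths event_desc es \<subseteq> Des J}"
    by simp
  have "(\<Sum>\<sigma>\<in>PP n I J. x ^ inv_count n \<sigma>) = (\<Sum>\<sigma>\<in>PP n I J. x ^ sum_list (event_code {1..<n} (events \<sigma>)))"
    using code by (intro sum.cong refl) (simp add: PP_def inv_count_eq_sum_word_code code_def)
  also note sum.reindex_bij_betw[OF b]
  finally show ?thesis .
qed

section \<open>The statistics st and maj on records\<close>

lemma st_eq_sum:
  assumes "is_comp n K" "is_comp n I"
  shows "st K I = (\<Sum>s\<in>(\<lambda>d. n - d) ` Des I. card {x \<in> (\<lambda>d. n - d) ` Des K. x \<le> s})"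
proof -
  have K: "a < n" if "a \<in> Des K" for a using Des_subset[OF assms(1)] that by auto
  have I: "a < n" if "a \<in> Des I" for a using Des_subset[OF assms(2)] that by auto
  have KK: "n - (n - a) = a" if "a \<in> Des K" for a using K[OF that] by simp
  have II: "n - (n - a) = a" if "a \<in> Des I" for a using I[OF that] by simp
  \<comment> \<open>Reflection reverses the order, so the two components trade places: b \<le> a
    becomes n - a \<le> n - b.\<close>
  have "bij_betw (\<lambda>(a, b). (n - b, n - a)) {(a, b). a \<in> Des K \<and> b \<in> Des I \<and> b \<le> a}
    (Sigma ((\<lambda>d. n - d) ` Des I) (\<lambda>s. {x \<in> (\<lambda>d. n - d) ` Des K. x \<le> s}))"
    by (rule bij_betw_byWitness[where f' = "\<lambda>(a, b). (n - b, n - a)"])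
      (auto simp: KK II dest: K I)
  then have "st K I = card (Sigma ((\<lambda>d. n - d) ` Des I) (\<lambda>s. {x \<in> (\<lambda>d. n - d) ` Des K. x \<le> s}))"
    unfolding st_def by (rule bij_betw_same_card)
  then show ?thesis by simp
qed

text \<open>Write \<open>maj (rev I)\<close> as the sum of the marks and each mark s as the number
  of elements of {1..s}. Those in the reflected \<open>Des K\<close> add up to
  \<open>st K I\<close>, the others to the gap between the two codes.\<close>

lemma sum_event_code_eq:
  assumes "is_comp n K" "is_comp n I" "valid_events es"
    and "marks es = (\<lambda>d. n - d) ` Des I" "Des I \<subseteq> Des K"
  shows "sum_list (event_code {1..<n} es) + st K I
    = sum_list (event_code ((\<lambda>d. n - d) ` Des K) es) + maj (rev I)"
proof -
  let ?E = "(\<lambda>d. n - d) ` Des K"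
  have E: "?E \<subseteq> {1..<n}" using reflect_subset[OF Des_subset[OF assms(1)]] .
  then have fin: "finite ?E" by simp
  have m: "marks es \<subseteq> ?E" using assms(4,5) by blast
  have "maj (rev I) = (\<Sum>s\<in>marks es. s)"
    using maj_eq_sum_Des[of n "rev I"] Des_rev[OF assms(2)] assms(2,4) by simp
  also have "\<dots> = (\<Sum>s\<in>marks es. card {x \<in> ?E. x \<le> s} + card {x \<in> {1..<n} - ?E. x \<le> s})"
  proof (rule sum.cong[OF refl])
    fix s assume "s \<in> marks es"
    then have "s \<in> {1..<n}" using m E by blast
    then have "s < n" by simp
    then have "{1..s} = {x \<in> ?E. x \<le> s} \<union> {x \<in> {1..<n} - ?E. x \<le> s}"
      using E by auto
    then have "card {1..s} = card ({x \<in> ?E. x \<le> s} \<union> {x \<in> {1..<n} - ?E. x \<le> s})" by simp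
    also have "\<dots> = card {x \<in> ?E. x \<le> s} + card {x \<in> {1..<n} - ?E. x \<le> s}"
      using fin by (intro card_Un_disjoint) auto
    finally show "s = card {x \<in> ?E. x \<le> s} + card {x \<in> {1..<n} - ?E. x \<le> s}" by simp
  qed
  also have "\<dots> = st K I + (\<Sum>s\<in>marks es. card {x \<in> {1..<n} - ?E. x \<le> s})"
    using st_eq_sum[OF assms(1,2)] assms(4) by (simp add: sum.distrib)
  finally show ?thesis
    using sum_event_code_mono[of "{1..<n}" ?E es, OF _ E assms(3) m] by simp
qed

section \<open>Triangularity of L and uniqueness of coefficients\<close>

lemma LJ_triangular:
  fixes c :: "nat list \<Rightarrow> 'k::field_char_0 poly fract"
  assumes "\<And>K. K \<in> comps n \<Longrightarrow> (\<Sum>I\<in>comps n. c I * LJ I K) = 0" and "K \<in> comps n"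
  shows "c K = 0"
  using assms(2)
proof (induction "card (Des K)" arbitrary: K rule: less_induct)
  case less
  \<comment> \<open>\<open>LJ I K\<close> vanishes unless \<open>Des I\<close> is contained in
    \<open>Des K\<close>. Proper containment means a smaller descent set, where the induction
    hypothesis applies; only the diagonal term remains, with a power of q as factor.\<close>
  have "c I * LJ I K = 0" if I: "I \<in> comps n - {K}" for I
  proof (cases "finer K I")
    case True
    have "Des I \<noteq> Des K" using I less.prems Des_inject by (auto simp: comps_def)
    then have "card (Des I) < card (Des K)"
      using True by (intro psubset_card_mono) (auto simp: finer_def)
    then show ?thesis using less.hyps I by simp
  qed (simp add: LJ_def)
  then have "(\<Sum>I\<in>comps n. c I * LJ I K) = c K * LJ K K"
    using less.prems by (subst sum.remove[of _ K]) (simp_all add: sum.neutral)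
  then show ?case using assms(1)[OF less.prems] by (simp add: LJ_def finer_def)
qed

lemma L_coeff_eqI:
  assumes "\<And>I. I \<notin> comps n \<Longrightarrow> c I = 0"
    and "\<And>K. K \<in> comps n \<Longrightarrow> F K = (\<Sum>I\<in>comps n. c I * LJ I K)"
  shows "L_coeff n F = c"
  unfolding L_coeff_def
proof (rule the_equality)
  fix d assume d: "(\<forall>I. I \<notin> comps n \<longrightarrow> d I = 0) \<and> (\<forall>K\<in>comps n. F K = (\<Sum>I\<in>comps n. d I * LJ I K))"
  show "d = c"
  proof
    fix K
    show "d K = c K"
    proof (cases "K \<in> comps n")
      case True
      \<comment> \<open>The difference of two solutions solves the homogeneous system.\<close>
      have "(\<Sum>I\<in>comps n. (d I - c I) * LJ I K') = 0" if "K' \<in> comps n" for K'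
        using d assms(2)[OF that] that by (simp add: left_diff_distrib sum_subtractf)
      from LJ_triangular[of n "\<lambda>I. d I - c I", OF this True] show ?thesis by simp
    next
      case False
      then show ?thesis using d assms(1) by simp
    qed
  qed
qed (use assms in blast)

theorem mainTheorem6:
  fixes n :: nat and I J :: "nat list"
  assumes "is_comp n I" and "is_comp n J"
  shows "L_coeff n (SJ J :: nat list \<Rightarrow> 'k::field_char_0 poly fract) I
       = qvar powi (- int (maj (rev I))) * (\<Sum>\<sigma>\<in>PP n I J. qvar ^ inv_count n \<sigma>)"
proof -
  let ?q = "qvar :: 'k poly fract"
  \<comment> \<open>The value 0 off \<open>comps n\<close> is the normalisation built into
    \<open>L_coeff\<close>, which makes the coefficient function unique.\<close>
  define c where "c = (\<lambda>I. if I \<in> comps n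
    then ?q powi (- int (maj (rev I))) * (\<Sum>\<sigma>\<in>PP n I J. ?q ^ inv_count n \<sigma>) else 0)"
  have "SJ J K = (\<Sum>I\<in>comps n. c I * LJ I K)" if "K \<in> comps n" for K
  proof -
    have K: "is_comp n K" using that by (simp add: comps_def)
    define E where "E = (\<lambda>d. n - d) ` Des K"
    have E: "E \<subseteq> {1..<n}" unfolding E_def by (rule reflect_subset[OF Des_subset[OF K]])
    define X where "X = {es. length es = n \<and> valid_events es \<and> marks es \<subseteq> E \<and>
      (\<lambda>e. n - e) ` suffix_lengths event_desc es \<subseteq> Des J}"
    \<comment> \<open>This sorts the records by their final S: the fibre over I consists of the
      records in X whose marks are the reflected \<open>Des I\<close>.\<close>
    define comp where "comp = (\<lambda>es :: (nat + nat) list. comp_of_des n ((\<lambda>e. n - e) ` marks es))"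
    have comp_iff: "comp es = I \<longleftrightarrow> marks es = (\<lambda>d. n - d) ` Des I"
      if "is_comp n I" "marks es \<subseteq> {1..<n}" for I es
    proof -
      have "comp es = I \<longleftrightarrow> Des I = (\<lambda>e. n - e) ` marks es"
        unfolding comp_def by (rule comp_of_des_eq_iff[OF reflect_subset[OF that(2)] that(1)])
      then show ?thesis
        using reflect_reflect[OF that(2)] reflect_reflect[OF Des_subset[OF that(1)]] by metis
    qed
    have "finite X"
    proof -
      have "bij_betw (event_code E) {es. length es = n \<and> valid_events es \<and> marks es \<subseteq> E} {b. length b = n \<and> box E b}"
        by (rule bij_betw_event_code[OF E])
      moreover have "finite {b. length b = n \<and> box E b}"
        using bij_betw_finite[OF bij_betw_word_code[OF E]] by simp
      ultimately have "finite {es. length es = n \<and> valid_events es \<and> marks es \<subseteq> E}"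
        using bij_betw_finite by blast
      then show ?thesis by (rule rev_finite_subset) (auto simp: X_def)
    qed
    have X_sub: "marks es \<subseteq> {1..<n}" if "es \<in> X" for es using that E by (auto simp: X_def)
    have coeff: "c I * LJ I K = (\<Sum>es\<in>{es \<in> X. comp es = I}. ?q ^ sum_list (event_code E es))"
      if "I \<in> comps n" for I
    proof -
      have I: "is_comp n I" using that by (simp add: comps_def)
      show ?thesis
      proof (cases "Des I \<subseteq> Des K")
        case True
        let ?Y = "{es. length es = n \<and> valid_events es \<and> marks es = (\<lambda>d. n - d) ` Des I \<and>
          (\<lambda>e. n - e) ` suffix_lengths event_desc es \<subseteq> Des J}"
        have "(\<lambda>d. n - d) ` Des I \<subseteq> E" using True by (auto simp: E_def)
        then have Y: "{es \<in> X. comp es = I} = ?Y"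
          using comp_iff[OF I] E by (fastforce simp: X_def)
        have "c I * LJ I K = ?q powi (- int (maj (rev I))) * ?q ^ st K I *
            (\<Sum>es\<in>?Y. ?q ^ sum_list (event_code {1..<n} es))"
          using that True sum_PP_eq_sum_events[OF I, of ?q J]
          by (simp add: c_def LJ_def finer_def mult_ac)
        also have "\<dots> = (\<Sum>es\<in>?Y. ?q ^ sum_list (event_code E es))"
          unfolding sum_distrib_left
        proof (rule sum.cong[OF refl])
          fix es assume "es \<in> ?Y"
          then have *: "sum_list (event_code {1..<n} es) + st K I = sum_list (event_code E es) + maj (rev I)"
            unfolding E_def using True by (intro sum_event_code_eq[OF K I]) auto
          have "?q powi (- int (maj (rev I))) * ?q ^ st K I * ?q ^ sum_list (event_code {1..<n} es)
              = ?q powi (- int (maj (rev I))) * ?q ^ (sum_list (event_code {1..<n} es) + st K I)"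
            by (simp add: power_add mult_ac)
          \<comment> \<open>The exponent is now the sum for E plus \<open>maj (rev I)\<close>, and
            the negative power cancels the latter.\<close>
          also have "\<dots> = ?q ^ sum_list (event_code E es)"
            unfolding * by (simp add: power_add power_int_minus)
          finally show "?q powi (- int (maj (rev I))) * ?q ^ st K I * ?q ^ sum_list (event_code {1..<n} es)
              = ?q ^ sum_list (event_code E es)" .
        qed
        finally show ?thesis using Y by simp
      next
        case False
        \<comment> \<open>Here \<open>LJ I K\<close> is 0, and no record in X can end with the
          reflected \<open>Des I\<close>, because its marks stay in E.\<close>
        have "comp es \<noteq> I" if es: "es \<in> X" for es
        proof
          assume "comp es = I"
          then have "marks es = (\<lambda>d. n - d) ` Des I" using comp_iff[OF I X_sub[OF es]] by simp
          then have "(\<lambda>d. n - d) ` Des I \<subseteq> E" using es by (auto simp: X_def)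
          then have "(\<lambda>d. n - d) ` (\<lambda>d. n - d) ` Des I \<subseteq> (\<lambda>d. n - d) ` (\<lambda>d. n - d) ` Des K"
            unfolding E_def by (rule image_mono)
          then show False
            using False reflect_reflect[OF Des_subset[OF I]] reflect_reflect[OF Des_subset[OF K]] by simp
        qed
        then have empty: "{es \<in> X. comp es = I} = {}" by blast
        show ?thesis unfolding empty using False by (simp add: LJ_def finer_def)
      qed
    qed
    have "comp ` X \<subseteq> comps n"
      using is_comp_comp_of_des[OF reflect_subset[OF X_sub]] by (auto simp: comp_def comps_def)
    then have "(\<Sum>es\<in>X. ?q ^ sum_list (event_code E es))
        = (\<Sum>I\<in>comps n. \<Sum>es\<in>{es \<in> X. comp es = I}. ?q ^ sum_list (event_code E es))"
      using \<open>finite X\<close> by (intro sum.group[symmetric]) simp_all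
    also have "\<dots> = (\<Sum>I\<in>comps n. c I * LJ I K)"
      by (rule sum.cong[OF refl]) (simp add: coeff)
    finally show ?thesis
      using SJ_eq_sum_events[OF assms(2) K, where 'k = 'k] by (simp add: X_def E_def)
  qed
  moreover have "c I = 0" if "I \<notin> comps n" for I using that by (simp add: c_def)
  ultimately have "L_coeff n (SJ J) = c" by (intro L_coeff_eqI)
  then show ?thesis using assms(1) by (simp add: c_def comps_def)
qed

end
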